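(* Let $\mathscr{L}\text{-}\mathscr{P}_{\mathbb N}^+$ and the operator $\widetilde S_4$ be as defined in the context. Then $\widetilde S_4[\mathscr{L}\text{-}\mathscr{P}_{\mathbb N}^+]\subseteq \mathscr{L}\text{-}\mathscr{P}_{\mathbb N}^+\cup\{0\}$. That is, for every polynomial $\sum_{k=0}^n a_kx^k\in\mathscr{L}\text{-}\mathscr{P}_{\mathbb N}^+$, the polynomial $\sum_{k=0}^n (a_ka_{k+1}-a_{k-4}a_{k+5})x^k$ (with $a_j=0$ for $j\notin\{0,1,\dots,n\}$) belongs to $\mathscr{L}\text{-}\mathscr{P}_{\mathbb N}^+\cup\{0\}$.
   Context: The Laguerre-Pólya class $\mathscr{L}\text{-}\mathscr{P}$ consists of the real entire functions that are limits, uniformly on compact subsets of $\mathbb C$, of real polynomials with only real zeros. $\mathscr{L}\text{-}\mathscr{P}^+$ is the subclass of those functions in $\mathscr{L}\text{-}\mathscr{P}$ with non-negative Taylor coefficients (at $0$). $\mathscr{L}\text{-}\mathscr{P}_{\mathbb N}^+ := \mathbb R[x]\cap\mathscr{L}\text{-}\mathscr{P}^+$, i.e. the real polynomials with non-negative coefficients all of whose zeros are real. For a sequence $\alpha=\{\alpha_k\}_{k=0}^\infty$ and a polynomial $\sum_{k=0}^n a_kx^k$, put $c_k(\alpha)=\sum_{j=0}^\infty \alpha_j a_{k-j}a_{k+1+j}$, where $a_j=0$ if $j\notin\{0,1,\dots,n\}$, and define the non-linear operator $V_\alpha\left(\sum_{k=0}^n a_kx^k\right)=\sum_{k=0}^n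 c_k(\alpha)x^k$. For a positive integer $r$, $\widetilde S_r:=V_\alpha$ with $\alpha_0=1$, $\alpha_r=-1$ and $\alpha_k=0$ for $k\notin\{0,r\}$. Thus $\widetilde S_r\left[\sum_{k=0}^n a_kx^k\right]=\sum_{k=0}^n (a_ka_{k+1}-a_{k-r}a_{k+r+1})x^k$. *)

theory Defs
  imports "HOL-Complex_Analysis.Complex_Analysis" "HOL-Computational_Algebra.Computational_Algebra"
begin

abbreviation cpoly :: "real poly \<Rightarrow> complex \<Rightarrow> complex" where
  "cpoly p z \<equiv> poly (map_poly complex_of_real p) z"

definition real_rooted :: "real poly \<Rightarrow> bool" where
  "real_rooted p \<longleftrightarrow> (\<forall>z. cpoly p z = 0 \<longrightarrow> z \<in> \<real>)"

(* The zero function, a limit of nonzero constants, is excluded: a polynomial belonging to the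
   class is to have only real zeros, and the operator theorems adjoin 0 to the target class. *)
definition laguerre_polya :: "(complex \<Rightarrow> complex) set" where
  "laguerre_polya = {f. f holomorphic_on UNIV \<and> (\<forall>x\<in>\<real>. f x \<in> \<real>) \<and> f \<noteq> (\<lambda>z. 0) \<and>
     (\<exists>P :: nat \<Rightarrow> real poly. (\<forall>n. real_rooted (P n)) \<and>
        (\<forall>K. compact K \<longrightarrow> uniform_limit K (\<lambda>n. cpoly (P n)) f sequentially))}"

definition laguerre_polya_plus :: "(complex \<Rightarrow> complex) set" where
  "laguerre_polya_plus =
     {f \<in> laguerre_polya. \<forall>k. (deriv ^^ k) f 0 / fact k \<in> \<real>\<^sub>\<ge>\<^sub>0}"

definition LP_plus_poly :: "real poly set" where
  "LP_plus_poly = {p. cpoly p \<in> laguerre_polya_plus}"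

definition icoeff :: "real poly \<Rightarrow> int \<Rightarrow> real" where
  "icoeff p i = (if i < 0 then 0 else coeff p (nat i))"

(* Only the terms with j \<le> k of this series can be nonzero. *)
definition V_coeff :: "(nat \<Rightarrow> real) \<Rightarrow> real poly \<Rightarrow> nat \<Rightarrow> real" where
  "V_coeff \<alpha> p k = (\<Sum>j. \<alpha> j * icoeff p (int k - int j) * icoeff p (int k + 1 + int j))"

definition V_op :: "(nat \<Rightarrow> real) \<Rightarrow> real poly \<Rightarrow> real poly" where
  "V_op \<alpha> p = (\<Sum>k\<le>degree p. monom (V_coeff \<alpha> p k) k)"

(* Meant for r > 0 only. *)
definition S_tilde :: "nat \<Rightarrow> real poly \<Rightarrow> real poly" where
  "S_tilde r = V_op (\<lambda>k. if k = 0 then 1 else if k = r then -1 else 0)"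

lemma V_coeff_finite:
  "V_coeff \<alpha> p k = (\<Sum>j\<le>k. \<alpha> j * coeff p (k - j) * coeff p (k + 1 + j))"
proof -
  have "V_coeff \<alpha> p k =
      (\<Sum>j\<le>k. \<alpha> j * icoeff p (int k - int j) * icoeff p (int k + 1 + int j))"
    unfolding V_coeff_def by (rule suminf_finite) (auto simp: icoeff_def)
  also have "\<dots> = (\<Sum>j\<le>k. \<alpha> j * coeff p (k - j) * coeff p (k + 1 + j))"
  proof (rule sum.cong[OF refl])
    fix j assume "j \<in> {..k}"
    then have "nat (int k - int j) = k - j" "\<not> int k - int j < 0"
      "nat (int k + 1 + int j) = k + 1 + j" by auto
    then show "\<alpha> j * icoeff p (int k - int j) * icoeff p (int k + 1 + int j) =
        \<alpha> j * coeff p (k - j) * coeff p (k + 1 + j)"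
      by (simp add: icoeff_def)
  qed
  finally show ?thesis .
qed

lemma coeff_V_op: "coeff (V_op \<alpha> p) k = V_coeff \<alpha> p k"
proof -
  have "coeff (V_op \<alpha> p) k = (if k \<le> degree p then V_coeff \<alpha> p k else 0)"
    by (simp add: V_op_def coeff_sum)
  moreover have "V_coeff \<alpha> p k = 0" if "\<not> k \<le> degree p"
    using that by (auto simp: V_coeff_finite coeff_eq_0 intro!: sum.neutral)
  ultimately show ?thesis by simp
qed

lemma coeff_S_tilde:
  assumes "r > 0"
  shows "coeff (S_tilde r p) k =
    coeff p k * coeff p (k + 1) - (if r \<le> k then coeff p (k - r) else 0) * coeff p (k + r + 1)"
proof -
  let ?a = "\<lambda>k. if k = 0 then 1 else if k = r then -1 else (0::real)"
  have "coeff (S_tilde r p) k = (\<Sum>j\<le>k. ?a j * coeff p (k - j) * coeff p (k + 1 + j))"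
    unfolding S_tilde_def by (simp add: coeff_V_op V_coeff_finite)
  also have "\<dots> = (\<Sum>j\<le>k. (if j = 0 then coeff p k * coeff p (k + 1) else 0) -
       (if j = r then coeff p (k - r) * coeff p (k + r + 1) else 0))"
    using assms by (intro sum.cong) (auto simp: add_ac)
  also have "\<dots> = coeff p k * coeff p (k + 1) -
      (if r \<le> k then coeff p (k - r) else 0) * coeff p (k + r + 1)"
    by (simp add: sum_subtractf)
  finally show ?thesis .
qed

lemma higher_deriv_cpoly: "(deriv ^^ k) (cpoly p) = cpoly ((pderiv ^^ k) p)"
proof (induction k)
  case (Suc k)
  have "deriv (cpoly q) = cpoly (pderiv q)" for q
  proof
    fix z
    have "pderiv (map_poly complex_of_real q) = map_poly of_real (pderiv q)"
      by (intro poly_eqI) (simp add: coeff_pderiv coeff_map_poly)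
    then show "deriv (cpoly q) z = cpoly (pderiv q) z"
      by (metis DERIV_imp_deriv poly_DERIV)
  qed
  then show ?case using Suc by simp
qed simp

lemma taylor_coeff_cpoly: "(deriv ^^ k) (cpoly p) 0 / fact k = complex_of_real (coeff p k)"
proof -
  have "coeff ((pderiv ^^ k) p) 0 = fact k * coeff p k"
    by (simp add: coeff_higher_pderiv pochhammer_fact)
  then show ?thesis
    by (simp add: higher_deriv_cpoly poly_0_coeff_0 coeff_map_poly)
qed

lemma cpoly_of_real: "cpoly p (complex_of_real x) = complex_of_real (poly p x)"
  by (induction p) (auto simp: map_poly_pCons)

lemma cpoly_real: "x \<in> \<real> \<Longrightarrow> cpoly p x \<in> \<real>"
  by (metis Reals_cases Reals_of_real cpoly_of_real)

lemma cpoly_holomorphic: "cpoly p holomorphic_on S"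
  unfolding holomorphic_on_def field_differentiable_def
  using poly_DERIV has_field_derivative_at_within by blast

lemma cpoly_eq_0_iff: "map_poly complex_of_real p = 0 \<longleftrightarrow> p = 0"
  by (simp add: map_poly_eq_0_iff)

lemma real_rooted_nonzero: "real_rooted p \<Longrightarrow> p \<noteq> 0"
  by (auto simp: real_rooted_def dest: spec[of _ "\<i>"])

(* Hurwitz's theorem on each open half-plane: for polynomials, membership in the
   Laguerre-Polya class just means that all zeros are real. *)
lemma cpoly_in_laguerre_polya_iff: "cpoly p \<in> laguerre_polya \<longleftrightarrow> real_rooted p"
proof
  assume rr: "real_rooted p"
  have "cpoly p \<noteq> (\<lambda>z. 0)"
    using real_rooted_nonzero[OF rr] by (metis cpoly_eq_0_iff poly_all_0_iff_0)
  moreover have "uniform_limit K (\<lambda>n. cpoly p) (cpoly p) sequentially" for K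
    by (rule uniform_limit_const)
  ultimately show "cpoly p \<in> laguerre_polya"
    using rr cpoly_real cpoly_holomorphic[of p UNIV] unfolding laguerre_polya_def
    by (intro CollectI conjI ballI exI[of _ "\<lambda>n. p"] allI impI) auto
next
  assume L: "cpoly p \<in> laguerre_polya"
  then obtain P :: "nat \<Rightarrow> real poly" where rr: "\<And>n. real_rooted (P n)"
    and ul: "\<And>K. compact K \<Longrightarrow> uniform_limit K (\<lambda>n. cpoly (P n)) (cpoly p) sequentially"
    unfolding laguerre_polya_def by blast
  have "p \<noteq> 0" using L by (auto simp: laguerre_polya_def fun_eq_iff)
  have key: "cpoly p z \<noteq> 0"
    if S: "open S" "convex S" "z \<in> S" and nr: "\<And>w. w \<in> S \<Longrightarrow> w \<notin> \<real>" for S z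
  proof (cases "cpoly p constant_on S")
    case True
    show ?thesis
    proof
      assume "cpoly p z = 0"
      then have "S \<subseteq> {w. cpoly p w = 0}"
        using True S(3) unfolding constant_on_def by auto
      moreover have "finite {w. cpoly p w = 0}"
        using \<open>p \<noteq> 0\<close> by (intro poly_roots_finite) (simp add: cpoly_eq_0_iff)
      ultimately have "finite S" by (rule finite_subset)
      then show False using S finite_imp_not_open by blast
    qed
  next
    case False
    show ?thesis
    proof (rule Hurwitz_no_zeros[of S "\<lambda>n. cpoly (P n)" "cpoly p"])
      show "connected S" using S by (simp add: convex_connected)
      show "cpoly (P n) w \<noteq> 0" if "w \<in> S" for n w
        using rr nr[OF that] by (auto simp: real_rooted_def)
    qed (use S ul False in \<open>auto intro: cpoly_holomorphic\<close>)
  qed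
  show "real_rooted p"
    unfolding real_rooted_def
  proof (intro allI impI)
    fix z assume z: "cpoly p z = 0"
    have "\<not> Im z > 0"
      using key[of "{w. Im w > 0}" z] z
      by (auto simp: open_halfspace_Im_gt convex_halfspace_Im_gt complex_is_Real_iff)
    moreover have "\<not> Im z < 0"
      using key[of "{w. Im w < 0}" z] z
      by (auto simp: open_halfspace_Im_lt convex_halfspace_Im_lt complex_is_Real_iff)
    ultimately show "z \<in> \<real>" by (simp add: complex_is_Real_iff)
  qed
qed

lemma LP_plus_poly_iff: "p \<in> LP_plus_poly \<longleftrightarrow> real_rooted p \<and> (\<forall>k. coeff p k \<ge> 0)"
  by (auto simp: LP_plus_poly_def laguerre_polya_plus_def cpoly_in_laguerre_polya_iff
      taylor_coeff_cpoly)

end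

theory Submission
  imports Defs
begin

text \<open>
  Let \<open>P = (\<Prod>s\<in>#S. [:s, 1:])\<close> with coefficients \<open>a\<^sub>k\<close> and all \<open>s \<ge> 0\<close>, and let \<open>Q\<close> be its image. The
  coefficients of \<open>u\<close> and of \<open>u ^ 9\<close> in the Laurent polynomial \<open>P (y u) * P (y / u)\<close> have the difference
  \<open>y * Q (y\<^sup>2)\<close>. On the other hand \<open>P (y u) * P (y / u) = H (u + 1 / u)\<close>, where \<open>H\<close> is the product of the
  factors \<open>y\<^sup>2 + s\<^sup>2 + s y t\<close> in the variable \<open>t\<close>. Expanding the powers of \<open>u + 1 / u\<close> shows that \<open>y * Q (y\<^sup>2)\<close> is the value at
  \<open>t = 0\<close> of the differential operator \<open>D f (D\<^sup>2)\<close> applied to \<open>H\<close>, up to the factor \<open>6\<close>, with the entire function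
  \<open>f x = 6 (\<Sum>m. (1 / (m! (m + 1)!) - 1 / ((m - 4)! (m + 5)!)) x ^ m)\<close>, where \<open>1 / (m - 4)!\<close> stands for \<open>0\<close>
  if \<open>m < 4\<close> (lemma \<open>S_tilde_autocorr\<close>).

  If \<open>Re y > 0\<close>, then the zeros \<open>- (y / s + s / y)\<close> of \<open>H\<close> have negative real parts. Differentiation preserves this,
  by the Gauss--Lucas theorem, and so does \<open>1 + b D\<^sup>2\<close> for \<open>b > 0\<close> (lemma
  \<open>umbral_eval_half_plane\<close>). Hence \<open>y * Q (y\<^sup>2) \<noteq> 0\<close> whenever \<open>f\<close> is a limit of products of factors
  \<open>1 + b x\<close> with \<open>b > 0\<close>, up to Hurwitz's theorem for the limit
  (lemma \<open>S_tilde_nonzero_right_half_plane\<close>). Then all zeros of \<open>Q\<close> are real and nonpositive.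

  At \<open>x = - v\<^sup>2 / 4\<close> the function \<open>f\<close> is a multiple of \<open>(J\<^sub>1 v - J\<^sub>9 v) / v\<close>, so the zeros of
  \<open>J\<^sub>1 - J\<^sub>9\<close> have to be controlled. The recurrence relations
  of the Bessel functions express this difference through \<open>J\<^sub>5\<close> and its derivative: with \<open>y\<close> the
  series with coefficients \<open>5! / (j! (j + 5)!)\<close>, one has \<open>f x = (6 - x) y x + x (x + 18) y' x\<close>.
  Here \<open>y\<close> is the limit of rescaled Laguerre polynomials \<open>p\<close>, which are
  real-rooted, and for large degree the zeros of \<open>p\<close> are below \<open>- 18\<close>, by the third Rayleigh sum
  (lemma \<open>laguerre_factorization\<close>). A partial fraction argument then shows that
  \<open>(6 - x) p + x (x + 18) p'\<close> is real-rooted (lemma \<open>real_rooted_bessel_comb\<close>).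
\<close>

section \<open>Logarithmic derivatives and half-planes\<close>

lemma sum_mset_pos:
  fixes g :: "'b \<Rightarrow> real"
  assumes "\<And>i. i \<in># A \<Longrightarrow> g i > 0" and "A \<noteq> {#}"
  shows "(\<Sum>i\<in>#A. g i) > 0"
  using assms
proof (induction A)
  case (add x A)
  then show ?case by (cases "A = {#}") (auto intro: add_pos_pos)
qed simp

lemma Re_sum_mset: "Re (\<Sum>i\<in>#A. g i) = (\<Sum>i\<in>#A. Re (g i))"
  by (induction A) auto

lemma poly_pderiv_prod_mset:
  fixes f :: "'b \<Rightarrow> 'a::field poly"
  assumes "\<And>i. i \<in># I \<Longrightarrow> poly (f i) z \<noteq> 0"
  shows "poly (pderiv (\<Prod>i\<in>#I. f i)) z =
    poly (\<Prod>i\<in>#I. f i) z * (\<Sum>i\<in>#I. poly (pderiv (f i)) z / poly (f i) z)"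
  using assms
  by (induction I) (auto simp: pderiv_mult field_simps)

lemma poly_prod_mset_nonzero:
  fixes f :: "'b \<Rightarrow> 'a::idom poly"
  assumes "\<And>i. i \<in># I \<Longrightarrow> poly (f i) z \<noteq> 0"
  shows "poly (\<Prod>i\<in>#I. f i) z \<noteq> 0"
  using assms by (induction I) auto

text \<open>For every zero \<open>r\<close> of \<open>h\<close>, the point \<open>u * (t - r)\<close> lies in the open right half-plane, hence so
  does its inverse, and \<open>h' t / h t\<close> is \<open>u\<close> times the sum of these inverses. The half-plane in
  which \<open>h\<close> has no zero is described by an arbitrary direction \<open>u\<close> so that right half-planes (for
  stability) and upper or lower ones (for real-rootedness) are treated together.\<close>
lemma half_plane_log_derivative:
  fixes h :: "complex poly"
  assumes nz: "\<And>z. Re (u * z) \<ge> c \<Longrightarrow> poly h z \<noteq> 0" and t: "Re (u * t) \<ge> c"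
  obtains w where "poly (pderiv h) t = poly h t * (u * w)" "w = 0 \<and> degree h = 0 \<or> Re w > 0"
proof -
  have "h \<noteq> 0" using nz[OF t] by auto
  then obtain A where A: "size A = degree h" "h = smult (lead_coeff h) (\<Prod>x\<in>#A. [:-x, 1:])"
    using alg_closed_imp_factorization by blast
  define g where "g = (\<Prod>x\<in>#A. [:-x, 1:])"
  have h: "h = smult (lead_coeff h) g" using A by (simp add: g_def)
  have outside: "Re (u * x) < c" if "x \<in># A" for x
  proof (rule ccontr)
    assume "\<not> Re (u * x) < c"
    then have "poly h x \<noteq> 0" using nz by force
    moreover have "poly g x = 0"
      using that unfolding g_def poly_prod_mset by (auto simp: image_iff)
    ultimately show False by (subst (asm) h) simp
  qed
  have ne: "t - x \<noteq> 0" "u \<noteq> 0" if "x \<in># A" for x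
    using outside[OF that] t by auto
  have "poly (pderiv g) t = poly g t * (\<Sum>x\<in>#A. 1 / (t - x))"
    unfolding g_def using ne by (subst poly_pderiv_prod_mset) (auto simp: pderiv_pCons)
  also have "(\<Sum>x\<in>#A. 1 / (t - x)) = (\<Sum>x\<in>#A. u * (1 / (u * (t - x))))"
    using ne by (intro arg_cong[where f = sum_mset] image_mset_cong) (auto simp: field_simps)
  also have "\<dots> = u * (\<Sum>x\<in>#A. 1 / (u * (t - x)))"
    by (simp add: sum_mset_distrib_left)
  finally have "poly (pderiv h) t = poly h t * (u * (\<Sum>x\<in>#A. 1 / (u * (t - x))))"
    by (subst (1 2) h) (simp add: pderiv_smult)
  moreover have "Re (\<Sum>x\<in>#A. 1 / (u * (t - x))) > 0" if "A \<noteq> {#}"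
    unfolding Re_sum_mset
  proof (rule sum_mset_pos[OF _ that])
    fix x assume "x \<in># A"
    then have "Re (u * (t - x)) > 0" using outside[of x] t by (simp add: algebra_simps)
    moreover from this have "u * (t - x) \<noteq> 0" by (metis less_irrefl zero_complex.sel(1))
    ultimately show "Re (1 / (u * (t - x))) > 0"
      by (simp only: Re_divide) (auto simp: sum_power2_gt_zero_iff complex_eq_iff zero_less_divide_iff)
  qed
  ultimately show thesis using that A(1) by (cases "A = {#}") auto
qed

text \<open>The Gauss--Lucas theorem for half-planes.\<close>
lemma half_plane_pderiv:
  fixes h :: "complex poly"
  assumes "\<And>z. Re (u * z) \<ge> c \<Longrightarrow> poly h z \<noteq> 0" "degree h > 0" "u \<noteq> 0" "Re (u * t) \<ge> c"
  shows "poly (pderiv h) t \<noteq> 0"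
proof -
  obtain w where "poly (pderiv h) t = poly h t * (u * w)" "w = 0 \<and> degree h = 0 \<or> Re w > 0"
    using half_plane_log_derivative assms(1,4) by blast
  with assms show ?thesis by auto
qed

text \<open>At a zero of the combination, \<open>u * \<mu>\<close> would be \<open>- 1 / w\<close> for a number \<open>w\<close> with positive real
  part.\<close>
lemma half_plane_add_smult_pderiv:
  fixes h :: "complex poly"
  assumes nz: "\<And>z. Re (u * z) \<ge> c \<Longrightarrow> poly h z \<noteq> 0" and \<mu>: "Re (u * \<mu>) \<ge> 0"
    and t: "Re (u * t) \<ge> c"
  shows "poly (h + smult \<mu> (pderiv h)) t \<noteq> 0"
proof
  assume 0: "poly (h + smult \<mu> (pderiv h)) t = 0"
  obtain w where w: "poly (pderiv h) t = poly h t * (u * w)" "w = 0 \<and> degree h = 0 \<or> Re w > 0"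
    using half_plane_log_derivative[OF nz t] by blast
  have "poly h t * (1 + u * \<mu> * w) = 0" using 0 w(1) by (simp add: algebra_simps)
  then have eq: "1 + u * \<mu> * w = 0" using nz[OF t] by simp
  then have "w \<noteq> 0" by auto
  then have "Re w > 0" using w by auto
  from eq \<open>w \<noteq> 0\<close> have "u * \<mu> = - 1 / w"
    by (simp add: field_simps) (metis add.commute add_eq_0_iff mult.commute mult.left_commute)
  then have "Re (u * \<mu>) = Re (- 1 / w)" by simp
  also have "\<dots> < 0" using \<open>Re w > 0\<close>
    by (auto simp: Re_divide divide_less_0_iff sum_power2_gt_zero_iff)
  finally show False using \<mu> by simp
qed

section \<open>Real-rooted polynomials\<close>

lemma map_poly_of_real_add:
  "map_poly complex_of_real (p + q) = map_poly of_real p + map_poly of_real q"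
  by (intro poly_eqI) (simp add: coeff_map_poly)

lemma map_poly_of_real_mult:
  "map_poly complex_of_real (p * q) = map_poly of_real p * map_poly of_real q"
  by (intro poly_eqI) (simp add: coeff_map_poly coeff_mult)

lemma map_poly_of_real_pderiv:
  "map_poly complex_of_real (pderiv p) = pderiv (map_poly of_real p)"
  by (intro poly_eqI) (simp add: coeff_map_poly coeff_pderiv)

lemma map_poly_of_real_prod_linear:
  "map_poly complex_of_real (\<Prod>b\<in>#B. [:c, b:]) = (\<Prod>b\<in>#B. [:of_real c, of_real b:])"
  by (induction B) (simp_all add: map_poly_of_real_mult map_poly_pCons del: mult_pCons_left mult_pCons_right)

lemma real_rooted_monom: "real_rooted (monom 1 n)"
  by (auto simp: real_rooted_def map_poly_monom poly_monom)

lemma real_rooted_mult_right: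
  assumes "real_rooted (q * p)" shows "real_rooted p"
  using assms by (simp add: real_rooted_def map_poly_of_real_mult)

text \<open>Any non-real point lies in a half-plane, bounded by a line parallel to the real axis, that
  contains no zero of \<open>q\<close>; the parameter \<open>l\<close> is real, so \<open>u * l\<close> is purely imaginary.\<close>
lemma real_rooted_add_smult_pderiv:
  assumes "real_rooted q"
  shows "real_rooted (q + smult l (pderiv q))"
  unfolding real_rooted_def
proof (intro allI impI)
  fix z assume z: "cpoly (q + smult l (pderiv q)) z = 0"
  have eq: "map_poly complex_of_real (q + smult l (pderiv q)) =
      map_poly of_real q + smult (of_real l) (pderiv (map_poly of_real q))"
    by (intro poly_eqI) (simp add: coeff_map_poly coeff_pderiv)
  show "z \<in> \<real>"
  proof (rule ccontr)
    assume "z \<notin> \<real>"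
    then have im: "Im z \<noteq> 0" by (simp add: complex_is_Real_iff)
    define u where "u = - \<i> * of_real (sgn (Im z))"
    have u: "Re (u * x) = sgn (Im z) * Im x" for x by (simp add: u_def)
    have "cpoly q x \<noteq> 0" if "Re (u * x) \<ge> \<bar>Im z\<bar>" for x
    proof
      assume "cpoly q x = 0"
      then have "Im x = 0" using assms by (auto simp: real_rooted_def complex_is_Real_iff)
      then show False using that im unfolding u by simp
    qed
    moreover have "Re (u * of_real l) \<ge> 0" "Re (u * z) \<ge> \<bar>Im z\<bar>"
      unfolding u by (auto simp: abs_sgn)
    ultimately show False using half_plane_add_smult_pderiv z unfolding eq by blast
  qed
qed

lemma real_rooted_iterate_add_smult_pderiv:
  "real_rooted q \<Longrightarrow> real_rooted (((\<lambda>q. q + smult l (pderiv q)) ^^ k) q)"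
  by (induction k) (auto intro: real_rooted_add_smult_pderiv)

lemma poly_pos_of_nonneg_coeffs:
  fixes p :: "real poly"
  assumes "\<And>k. coeff p k \<ge> 0" "p \<noteq> 0" "x > 0"
  shows "poly p x > 0"
proof -
  have "lead_coeff p > 0" using assms(1)[of "degree p"] assms(2) by (metis leading_coeff_0_iff less_eq_real_def)
  then have "coeff p (degree p) * x ^ degree p > 0" using assms(3) by simp
  then show ?thesis
    unfolding poly_altdef using assms(1,3) by (intro sum_pos2[where i = "degree p"]) auto
qed

lemma real_rooted_factorization:
  assumes "real_rooted p"
  obtains A where "p = smult (lead_coeff p) (\<Prod>x\<in>#A. [:-x, 1:])"
    "\<And>x. x \<in># A \<Longrightarrow> poly p x = 0"
proof -
  have "\<exists>A. p = smult (lead_coeff p) (\<Prod>x\<in>#A. [:-x, 1:])"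
    using assms
  proof (induction "degree p" arbitrary: p)
    case 0
    then show ?case by (intro exI[of _ "{#}"]) (auto elim!: degree_eq_zeroE)
  next
    case (Suc n)
    have "\<not> constant (cpoly p)"
      using Suc(2) by (simp add: constant_degree degree_map_poly)
    then obtain z where z: "cpoly p z = 0" using fundamental_theorem_of_algebra by blast
    then have "z \<in> \<real>" using Suc.prems by (auto simp: real_rooted_def)
    then obtain x where "z = of_real x" by (auto elim: Reals_cases)
    then have "poly p x = 0" using z by (simp add: cpoly_of_real)
    then obtain q where q: "p = [:-x, 1:] * q" by (auto simp: poly_eq_0_iff_dvd)
    have "q \<noteq> 0" using real_rooted_nonzero[OF Suc.prems] q by auto
    have deg: "degree p = Suc (degree q)" using \<open>q \<noteq> 0\<close> unfolding q by (subst degree_mult_eq) auto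
    have lc: "lead_coeff p = lead_coeff q" unfolding q by (simp add: lead_coeff_mult del: mult_pCons_left)
    have "real_rooted q"
      unfolding real_rooted_def
    proof (intro allI impI)
      fix w assume "cpoly q w = 0"
      moreover have "map_poly complex_of_real p = [:-of_real x, 1:] * map_poly of_real q"
        unfolding q by (intro poly_eqI) (simp add: coeff_map_poly coeff_pCons split: nat.split)
      ultimately have "cpoly p w = 0" by simp
      then show "w \<in> \<real>" using Suc.prems by (auto simp: real_rooted_def)
    qed
    moreover have "n = degree q" using deg Suc.hyps(2) by simp
    ultimately have "\<exists>A. q = smult (lead_coeff q) (\<Prod>x\<in>#A. [:-x, 1:])"
      by (intro Suc.hyps(1))
    then obtain A where A: "q = smult (lead_coeff q) (\<Prod>x\<in>#A. [:-x, 1:])"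
      by (elim exE) (rule that)
    have "p = [:-x, 1:] * smult (lead_coeff q) (\<Prod>x\<in>#A. [:-x, 1:])"
      unfolding q by (rule arg_cong[where f = "\<lambda>r. [:-x, 1:] * r", OF A])
    also have "\<dots> = smult (lead_coeff p) (\<Prod>x\<in>#add_mset x A. [:-x, 1:])"
      unfolding lc by (simp only: image_mset_add_mset prod_mset.add_mset mult_smult_right)
    finally have "p = smult (lead_coeff p) (\<Prod>x\<in>#add_mset x A. [:-x, 1:])" .
    then show ?case by (rule exI)
  qed
  then obtain A where A: "p = smult (lead_coeff p) (\<Prod>x\<in>#A. [:-x, 1:])"
    by (elim exE) (rule that)
  have "poly p x = 0" if "x \<in># A" for x
  proof -
    have "poly (\<Prod>x\<in>#A. [:-x, 1:]) x = 0"
      using that unfolding poly_prod_mset by (auto simp: image_iff)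
    then show ?thesis by (subst A) simp
  qed
  then show thesis by (rule that[OF A])
qed

lemma real_rooted_nonneg_coeffs_factorization:
  assumes "real_rooted p" "\<And>k. coeff p k \<ge> 0"
  obtains A where "p = smult (lead_coeff p) (\<Prod>s\<in>#A. [:s, 1:])"
    "\<And>s. s \<in># A \<Longrightarrow> s \<ge> 0" "\<And>s. s \<in># A \<Longrightarrow> poly p (-s) = 0"
proof -
  obtain A where A: "p = smult (lead_coeff p) (\<Prod>x\<in>#A. [:-x, 1:])"
    "\<And>x. x \<in># A \<Longrightarrow> poly p x = 0"
    by (rule real_rooted_factorization[OF assms(1)], rule that)
  have "x \<le> 0" if "x \<in># A" for x
  proof (rule ccontr)
    assume "\<not> x \<le> 0"
    then have "poly p x > 0"
      using poly_pos_of_nonneg_coeffs assms(2) real_rooted_nonzero[OF assms(1)] by simp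
    then show False using A(2)[OF that] by simp
  qed
  then have neg: "s \<ge> 0 \<and> poly p (-s) = 0" if "s \<in># image_mset uminus A" for s
    using that A(2) by auto
  have eq: "(\<Prod>x\<in>#A. [:-x, 1:]) = (\<Prod>s\<in>#image_mset uminus A. [:s, 1:])"
    by (simp add: multiset.map_comp o_def)
  show thesis
  proof (rule that)
    show "p = smult (lead_coeff p) (\<Prod>s\<in>#image_mset uminus A. [:s, 1:])"
      using A(1) unfolding eq .
  qed (use neg in auto)
qed

lemma real_rooted_pos_coeff_0_factorization:
  assumes "real_rooted p" "\<And>k. coeff p k \<ge> 0" "coeff p 0 > 0"
  obtains B where "p = smult (coeff p 0) (\<Prod>b\<in>#B. [:1, b:])" "\<And>b. b \<in># B \<Longrightarrow> b > 0"
proof -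
  obtain A where A: "p = smult (lead_coeff p) (\<Prod>s\<in>#A. [:s, 1:])"
    "\<And>s. s \<in># A \<Longrightarrow> s \<ge> 0" "\<And>s. s \<in># A \<Longrightarrow> poly p (-s) = 0"
    by (rule real_rooted_nonneg_coeffs_factorization[OF assms(1,2)], rule that)
  have "s \<noteq> 0" if "s \<in># A" for s
  proof
    assume "s = 0"
    then have "poly p 0 = 0" using A(3)[OF that] by simp
    then show False using assms(3) by (simp add: poly_0_coeff_0)
  qed
  then have pos: "s > 0" if "s \<in># A" for s using A(2) that by force
  define B where "B = image_mset inverse A"
  have eq: "(\<Prod>s\<in>#A. [:s, 1:]) = smult (prod_mset A) (\<Prod>b\<in>#B. [:1, b:])"
    unfolding B_def using pos
  proof (induction A)
    case (add s A)
    have s: "[:s, 1:] = smult s [:1, inverse s:]" using add.prems[of s] by simp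
    have IH: "(\<Prod>s\<in>#A. [:s, 1:]) = smult (prod_mset A) (\<Prod>b\<in>#image_mset inverse A. [:1, b:])"
      using add by simp
    have smult_mult: "smult a f * smult b g = smult (a * b) (f * g)" for a b :: real and f g
      by (simp add: mult.commute)
    show ?case
      by (simp only: image_mset_add_mset prod_mset.add_mset IH s[unfolded smult_mult] smult_mult)
  qed simp
  have p: "p = smult (lead_coeff p * prod_mset A) (\<Prod>b\<in>#B. [:1, b:])"
    using A(1) unfolding eq smult_smult .
  have "poly (\<Prod>b\<in>#B. [:1, b:]) 0 = 1" by (simp add: poly_prod_mset multiset.map_comp o_def)
  then have c0: "coeff p 0 = lead_coeff p * prod_mset A"
    using arg_cong[OF p, of "\<lambda>q. poly q 0"] by (simp add: poly_0_coeff_0)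
  show thesis
  proof (rule that)
    show "p = smult (coeff p 0) (\<Prod>b\<in>#B. [:1, b:])" unfolding c0 by (rule p)
    show "b > 0" if "b \<in># B" for b using that pos by (auto simp: B_def)
  qed
qed

section \<open>Laguerre polynomials as approximants of a Bessel function\<close>

text \<open>This is the binomial expansion of \<open>(1 + l D) ^ k\<close>, with \<open>D\<close> the derivative, applied to
  \<open>x ^ n\<close>.\<close>
lemma coeff_iterate_add_smult_pderiv_monom:
  fixes l :: "'a::field_char_0"
  shows "coeff (((\<lambda>q. q + smult l (pderiv q)) ^^ k) (monom 1 n)) i =
    (if i \<le> n then of_nat (k choose (n - i)) * l ^ (n - i) * fact n / fact i else 0)"
proof (induction k arbitrary: i)
  case 0
  show ?case by (auto simp: binomial_eq_0)
next
  case (Suc k)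
  define X where "X = ((\<lambda>q. q + smult l (pderiv q)) ^^ k) (monom 1 n)"
  have X: "coeff X i = (if i \<le> n then of_nat (k choose (n - i)) * l ^ (n - i) * fact n / fact i else 0)" for i
    unfolding X_def by (rule Suc)
  have step: "coeff (((\<lambda>q. q + smult l (pderiv q)) ^^ Suc k) (monom 1 n)) i =
      coeff X i + l * (of_nat (Suc i) * coeff X (Suc i))"
    by (simp only: funpow.simps o_apply X_def[symmetric] coeff_add coeff_smult coeff_pderiv)
  show ?case
  proof (cases "i < n")
    case True
    define d where "d = n - Suc i"
    have d: "n - i = Suc d" "n - Suc i = d" using True by (simp_all add: d_def)
    have "(of_nat (Suc i) :: 'a) \<noteq> 0" by (simp del: of_nat_Suc)
    then have "of_nat (Suc i) * coeff X (Suc i) = of_nat (k choose d) * l ^ d * fact n / fact i"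
      using True d(2) by (simp add: X fact_Suc del: of_nat_Suc)
    moreover have "coeff X i = of_nat (k choose Suc d) * l ^ Suc d * fact n / fact i"
      using True d(1) by (simp add: X)
    ultimately have "coeff X i + l * (of_nat (Suc i) * coeff X (Suc i)) =
        of_nat (Suc k choose Suc d) * l ^ Suc d * fact n / fact i"
      by (simp add: add_divide_distrib ring_distribs)
    then show ?thesis unfolding step using True d(1) by simp
  next
    case False
    then have "coeff X (Suc i) = 0" "n - i = 0" by (simp_all add: X)
    then show ?thesis unfolding step by (simp add: X)
  qed
qed

text \<open>A rescaled generalized Laguerre polynomial with parameter \<open>5\<close>, namely \<open>L M (- x / M)\<close> up to a
  constant. As \<open>M\<close> grows, it tends to the series with coefficients \<open>5! / (j! (j + 5)!)\<close>, which at
  \<open>x = - t\<^sup>2 / 4\<close> is \<open>5! (2 / t) ^ 5\<close> times the Bessel function \<open>J\<^sub>5 t\<close>.\<close>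
definition laguerre :: "nat \<Rightarrow> real poly" where
  "laguerre M = (\<Sum>j\<le>M. monom (fact 5 * real (M choose j) / (real M ^ j * fact (j + 5))) j)"

lemma coeff_laguerre:
  "coeff (laguerre M) j = fact 5 * real (M choose j) / (real M ^ j * fact (j + 5))"
  by (simp add: laguerre_def coeff_sum binomial_eq_0)

text \<open>Rodrigues' formula: up to a constant, \<open>x ^ 5\<close> times the polynomial is \<open>(1 + M D) ^ M\<close> applied
  to \<open>x ^ (M + 5)\<close>.\<close>
lemma real_rooted_laguerre:
  assumes "M > 0"
  shows "real_rooted (laguerre M)"
proof -
  define L where "L = ((\<lambda>q. q + smult (real M) (pderiv q)) ^^ M) (monom 1 (M + 5))"
  define c :: real where "c = real M ^ M * fact (M + 5) / fact 5"
  have "L = monom c 5 * laguerre M"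
  proof (rule poly_eqI)
    fix i
    show "coeff L i = coeff (monom c 5 * laguerre M) i"
    proof (cases "5 \<le> i \<and> i \<le> M + 5")
      case True
      then obtain j where j: "i = j + 5" "j \<le> M" by (metis add.commute le_Suc_ex nat_add_left_cancel_le)
      have "M choose (M - j) = M choose j" using j by (simp add: binomial_symmetric[symmetric])
      moreover have "real M ^ M = real M ^ (M - j) * real M ^ j"
        using j by (simp add: power_add[symmetric])
      ultimately show ?thesis using j assms
        by (simp add: L_def coeff_iterate_add_smult_pderiv_monom coeff_monom_mult coeff_laguerre c_def)
    qed (auto simp: L_def coeff_iterate_add_smult_pderiv_monom coeff_monom_mult coeff_laguerre binomial_eq_0)
  qed
  then have "real_rooted (monom c 5 * laguerre M)"
    unfolding L_def using real_rooted_iterate_add_smult_pderiv real_rooted_monom by metis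
  then show ?thesis by (rule real_rooted_mult_right)
qed

text \<open>Vieta's formulas together with Newton's identity for the third power sum.\<close>
lemma newton_cubes:
  fixes B :: "'a::comm_ring_1 multiset"
  defines "p \<equiv> (\<Prod>b\<in>#B. [:1, b:])"
  shows "coeff p 0 = 1" "coeff p 1 = (\<Sum>b\<in>#B. b)"
    "(\<Sum>b\<in>#B. b ^ 3) = coeff p 1 ^ 3 - 3 * coeff p 1 * coeff p 2 + 3 * coeff p 3"
proof -
  have "coeff (\<Prod>b\<in>#B. [:1, b:]) 0 = 1 \<and> coeff (\<Prod>b\<in>#B. [:1, b:]) 1 = (\<Sum>b\<in>#B. b) \<and>
    (\<Sum>b\<in>#B. b ^ 3) = coeff (\<Prod>b\<in>#B. [:1, b:]) 1 ^ 3
      - 3 * coeff (\<Prod>b\<in>#B. [:1, b:]) 1 * coeff (\<Prod>b\<in>#B. [:1, b:]) 2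
      + 3 * coeff (\<Prod>b\<in>#B. [:1, b:]) 3"
  proof (induction B)
    case (add b B)
    define f where "f = (\<Prod>b\<in>#B. [:1, b:])"
    have "coeff ([:1, b:] * f) (Suc k) = coeff f (Suc k) + b * coeff f k" for k
      by simp
    from this[of 0] this[of 1] this[of 2]
    have c: "coeff ([:1, b:] * f) 1 = coeff f 1 + b * coeff f 0"
      "coeff ([:1, b:] * f) 2 = coeff f 2 + b * coeff f 1"
      "coeff ([:1, b:] * f) 3 = coeff f 3 + b * coeff f 2"
      by (simp_all only: numeral_2_eq_2[symmetric] numeral_3_eq_3[symmetric] One_nat_def[symmetric] Suc_1 eval_nat_numeral)
    have c0: "coeff ([:1, b:] * f) 0 = coeff f 0" by simp
    have IH: "coeff f 0 = 1" "coeff f 1 = (\<Sum>b\<in>#B. b)"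
      "(\<Sum>b\<in>#B. b ^ 3) = coeff f 1 ^ 3 - 3 * coeff f 1 * coeff f 2 + 3 * coeff f 3"
      using add by (simp_all add: f_def)
    have "b ^ 3 + (\<Sum>b\<in>#B. b ^ 3) = (coeff f 1 + b * coeff f 0) ^ 3
        - 3 * (coeff f 1 + b * coeff f 0) * (coeff f 2 + b * coeff f 1)
        + 3 * (coeff f 3 + b * coeff f 2)"
      unfolding IH(1,3) by (simp add: power3_eq_cube algebra_simps del: One_nat_def)
    then show ?case
      using IH(1,2) c c0
      by (simp only: image_mset_add_mset prod_mset.add_mset sum_mset.add_mset f_def[symmetric]) (simp add: add.commute)
  qed (simp add: numeral_2_eq_2 numeral_3_eq_3)
  then show "coeff p 0 = 1" "coeff p 1 = (\<Sum>b\<in>#B. b)"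
    "(\<Sum>b\<in>#B. b ^ 3) = coeff p 1 ^ 3 - 3 * coeff p 1 * coeff p 2 + 3 * coeff p 3"
    by (simp_all add: p_def)
qed

text \<open>The bound \<open>18\<close> for the absolute value of the zeros is needed because \<open>x + 18\<close> is the factor of
  \<open>x p'\<close> in the definition of \<open>bessel_comb\<close> below. It comes from Rayleigh's method: the sum of the cubes of
  the numbers \<open>b\<close> tends to \<open>1 / 6048\<close>, whereas \<open>18\<^sup>3 = 5832\<close>. The sum of the squares tends to
  \<open>1 / 252\<close>, which is too large for the purpose since \<open>18\<^sup>2 = 324\<close>.\<close>
lemma laguerre_factorization:
  assumes M: "M \<ge> 1000"
  obtains B where "laguerre M = (\<Prod>b\<in>#B. [:1, b:])" "\<And>b. b \<in># B \<Longrightarrow> 0 < b \<and> b < 1 / 18"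
    "(\<Sum>b\<in>#B. b) = 1 / 6"
proof -
  have c0: "coeff (laguerre M) 0 = 1" by (simp add: coeff_laguerre)
  have "real_rooted (laguerre M)" using M by (intro real_rooted_laguerre) auto
  moreover have "coeff (laguerre M) k \<ge> 0" for k by (simp add: coeff_laguerre)
  ultimately obtain B where "laguerre M = smult (coeff (laguerre M) 0) (\<Prod>b\<in>#B. [:1, b:])"
    and pos: "\<And>b. b \<in># B \<Longrightarrow> b > 0"
    using real_rooted_pos_coeff_0_factorization[of "laguerre M"] c0 by (metis zero_less_one)
  then have p: "laguerre M = (\<Prod>b\<in>#B. [:1, b:])" by (simp add: c0)
  \<comment> \<open>With \<open>e = 1 / M\<close>, the cubes of the numbers \<open>b\<close> sum up to \<open>1 / 6048 + e / 672 + e\<^sup>2 / 336\<close>.\<close>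
  define e where "e = 1 / real M"
  have e: "0 < e" "e \<le> 1 / 1000" using M by (simp_all add: e_def field_simps)
  have c1: "coeff (laguerre M) 1 = 1 / 6"
    using M by (simp add: coeff_laguerre fact_numeral)
  have "real (M choose 2) = real M * (real M - 1) / 2"
    using M by (simp add: choose_two real_of_nat_div)
  then have c2: "coeff (laguerre M) 2 = (1 - e) / 84"
    using M by (simp add: coeff_laguerre e_def fact_numeral field_simps power2_eq_square)
  have "real (M choose 3) = real M * (real M - 1) * (real M - 2) / 6"
    by (simp add: binomial_gbinomial gbinomial_prod_rev numeral_3_eq_3)
  then have c3: "coeff (laguerre M) 3 = (1 - e) * (1 - 2 * e) / 2016"
    using M by (simp add: coeff_laguerre e_def fact_numeral field_simps power3_eq_cube)
  have "e * e \<le> 1 / 1000 * (1 / 1000)" using e by (intro mult_mono) auto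
  moreover have "(\<Sum>b\<in>#B. b ^ 3) = 1 / 6048 + e / 672 + e * e / 336"
    unfolding newton_cubes(3)[of B] p[symmetric] c1 c2 c3
    by (simp add: power3_eq_cube field_simps)
  ultimately have cubes: "(\<Sum>b\<in>#B. b ^ 3) < (1 / 18) ^ 3"
    using e(2) by (simp add: power3_eq_cube)
  have "b < 1 / 18" if "b \<in># B" for b
  proof -
    obtain C where C: "B = add_mset b C" using multi_member_split[OF \<open>b \<in># B\<close>] by blast
    have "(\<Sum>b\<in>#C. b ^ 3) \<ge> 0"
    proof -
      have "\<And>b. b \<in># C \<Longrightarrow> b > 0" using pos C by simp
      then show ?thesis by (induction C) (auto simp: less_imp_le)
    qed
    then have "b ^ 3 \<le> (\<Sum>b\<in>#B. b ^ 3)" using C by simp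
    then have "b ^ 3 < (1 / 18) ^ 3" using cubes by simp
    then show ?thesis by (rule power_less_imp_less_base) simp
  qed
  moreover have "(\<Sum>b\<in>#B. b) = 1 / 6" using newton_cubes(2)[of B] c1 p by simp
  ultimately show thesis using that p pos by blast
qed

lemma choose_over_power_tendsto: "(\<lambda>M. real (M choose j) / real M ^ j) \<longlonglongrightarrow> 1 / fact j"
proof (induction j)
  case (Suc j)
  have "(\<lambda>M. real (M choose j) / real M ^ j * ((1 - real j / real M) / real (Suc j)))
      \<longlonglongrightarrow> 1 / fact j * ((1 - 0) / real (Suc j))"
    by (intro tendsto_intros Suc lim_const_over_n) auto
  moreover have "eventually (\<lambda>M. real (M choose j) / real M ^ j * ((1 - real j / real M) / real (Suc j)) =
     real (M choose Suc j) / real M ^ Suc j) sequentially"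
    using eventually_ge_at_top[of "Suc j"]
  proof eventually_elim
    case (elim M)
    have "real (Suc j) * real (M choose Suc j) = real (M - j) * real (M choose j)"
      by (metis binomial_absorb_comp binomial_absorption of_nat_mult)
    then have eq: "real (M choose Suc j) = real (M choose j) * (real M - real j) / real (Suc j)"
      using elim by (simp add: field_simps of_nat_diff)
    have "real M > 0" using elim by simp
    then show ?case unfolding eq by (simp add: divide_simps del: of_nat_Suc)
  qed
  ultimately show ?case by (auto elim: Lim_transform_eventually simp: mult.commute)
qed simp

lemma coeff_laguerre_tendsto:
  "(\<lambda>M. coeff (laguerre M) j) \<longlonglongrightarrow> fact 5 / (fact j * fact (j + 5))"
proof -
  have "(\<lambda>M. fact 5 / fact (j + 5) * (real (M choose j) / real M ^ j)) \<longlonglongrightarrow>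
      fact 5 / fact (j + 5) * (1 / fact j)"
    by (intro tendsto_intros choose_over_power_tendsto)
  then show ?thesis by (simp add: coeff_laguerre mult.commute)
qed

section \<open>Real-rootedness of the approximants of the difference of two Bessel functions\<close>

lemma Im_of_real_divide: "Im (complex_of_real a / w) = - a * Im w / (cmod w)\<^sup>2"
  by (simp add: Im_divide cmod_power2)

text \<open>Let \<open>\<theta> = x D\<close>. If \<open>y\<close> solves the Bessel equation \<open>\<theta> (\<theta> + 5) y = x y\<close>, then the result for \<open>y\<close> is
  \<open>(\<theta> + 1) (\<theta>\<^sup>2 + 2 \<theta> + 6) y\<close>, which multiplies the coefficient of \<open>x ^ j\<close> by
  \<open>(j + 1) (j\<^sup>2 + 2 j + 6)\<close>. The factor \<open>\<theta>\<^sup>2 + 2 \<theta> + 6\<close> does not preserve real-rootedness in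
  general; this expression of first order in \<open>D\<close> does so, under the conditions below, even for
  polynomials \<open>p\<close> that only approximate such a \<open>y\<close>.\<close>
definition bessel_comb :: "real poly \<Rightarrow> real poly" where
  "bessel_comb p = [:6, -1:] * p + [:0, 18, 1:] * pderiv p"

lemma coeff_bessel_comb:
  "coeff (bessel_comb p) 0 = 6 * coeff p 0"
  "coeff (bessel_comb p) (Suc j) =
     (18 * real j + 24) * coeff p (Suc j) + (real j - 1) * coeff p j"
  by (cases j; simp add: bessel_comb_def coeff_pderiv coeff_pCons algebra_simps)+

text \<open>Write \<open>f\<close> for the combination and \<open>p\<close> for the product. If \<open>z\<close> and \<open>p z\<close> are nonzero, \<open>f z = 0\<close>
  means \<open>T z = 0\<close> for \<open>T z = 6 / z - 1 + (\<Sum>b\<in>#B. (z + 18) b / (1 + z b))\<close>. The imaginary parts of the terms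
  \<open>6 / z\<close> and \<open>(z + 18) b / (1 + z b)\<close> have opposite signs, so \<open>T\<close> itself gives no
  information. But \<open>f\<close> has a real zero \<open>r\<close> in \<open>(-6, 0)\<close>, and division of \<open>T z - T r\<close> by \<open>z - r\<close>
  reverses one of the signs: \<open>6 / (z r) = (\<Sum>b\<in>#B. b (1 - 18 b) / ((1 + z b) (1 + r b)))\<close>. As
  \<open>r < 0\<close> and \<open>b < 1 / 18\<close>, the two sides have imaginary parts of opposite signs for non-real \<open>z\<close>.

  The zero \<open>r\<close> exists because the combination is positive at \<open>0\<close> and negative at \<open>-6\<close>; the latter
  says that \<open>p' (-6) / p (-6)\<close> exceeds its value \<open>1 / 6\<close> at \<open>0\<close>.\<close>
lemma real_rooted_bessel_comb:
  fixes B :: "real multiset"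
  assumes B: "\<And>b. b \<in># B \<Longrightarrow> 0 < b \<and> b < 1 / 18" and sum: "(\<Sum>b\<in>#B. b) = 1 / 6"
  shows "real_rooted (bessel_comb (\<Prod>b\<in>#B. [:1, b:]))"
proof -
  define p where "p = (\<Prod>b\<in>#B. [:1, b:])"
  have ne: "B \<noteq> {#}" using sum by auto
  have pos: "1 + x * b > 0" if "b \<in># B" "x \<ge> -6" for b x
  proof -
    have "x * b \<ge> -6 * b" using that B[OF that(1)] by (intro mult_right_mono) auto
    then show ?thesis using B[OF that(1)] by simp
  qed
  have p_pos: "poly p x > 0" if "x \<ge> -6" for x
    unfolding p_def using pos[OF _ that]
  proof (induction B)
    case (add b B)
    have "0 < (1 + x * b) * poly (\<Prod>b\<in>#B. [:1, b:]) x"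
      using add by (intro mult_pos_pos) auto
    then show ?case by (simp add: algebra_simps)
  qed simp
  have p': "poly (pderiv p) x = poly p x * (\<Sum>b\<in>#B. b / (1 + x * b))" if "x \<ge> -6" for x
    unfolding p_def using pos[OF _ that]
    by (subst poly_pderiv_prod_mset) (auto simp: pderiv_pCons less_le)
  have f: "poly (bessel_comb p) x = poly p x * ((6 - x) + x * ((x + 18) * (\<Sum>b\<in>#B. b / (1 + x * b))))"
    if "x \<ge> -6" for x
    unfolding bessel_comb_def by (simp add: p'[OF that] algebra_simps)
  \<comment> \<open>The logarithmic derivative at \<open>-6\<close> compared with the one at \<open>0\<close>.\<close>
  have "(\<Sum>b\<in>#B. b / (1 - 6 * b) - b) > 0"
  proof (rule sum_mset_pos[OF _ ne])
    fix b assume b: "b \<in># B"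
    then have "b / (1 - 6 * b) - b = 6 * b\<^sup>2 / (1 - 6 * b)"
      using B[OF b] by (simp add: field_simps power2_eq_square)
    then show "b / (1 - 6 * b) - b > 0" using B[OF b] by simp
  qed
  also have "(\<Sum>b\<in>#B. b / (1 - 6 * b) - b) = (\<Sum>b\<in>#B. b / (1 - 6 * b)) - (\<Sum>b\<in>#B. b)"
    by (induction B) auto
  finally have "(\<Sum>b\<in>#B. b / (1 + (-6) * b)) > 1 / 6" using sum by simp
  then have "poly (bessel_comb p) (-6) < 0"
    using p_pos[of "-6"] by (simp add: f[of "-6"] mult_less_0_iff)
  moreover have "poly (bessel_comb p) 0 > 0" using p_pos[of 0] by (simp add: f[of 0])
  ultimately obtain r where r: "-6 < r" "r < 0" "poly (bessel_comb p) r = 0"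
    using poly_IVT_pos[of "-6" 0] by auto
  define S where "S = (\<lambda>z::complex. \<Sum>b\<in>#B. of_real b / (1 + z * of_real b))"
  have r0: "(6 - r) + r * ((r + 18) * (\<Sum>b\<in>#B. b / (1 + r * b))) = 0"
    using r f[of r] p_pos[of r] by simp
  have "complex_of_real (\<Sum>b\<in>#B. b / (1 + r * b)) = S (of_real r)"
    unfolding S_def by (induction B) auto
  then have Sr: "(of_real r + 18) * S (of_real r) = 1 - 6 / of_real r"
    using arg_cong[OF r0, of complex_of_real] r by (simp add: field_simps)
  show ?thesis
    unfolding real_rooted_def p_def[symmetric]
  proof (intro allI impI, rule ccontr)
    fix z assume z: "cpoly (bessel_comb p) z = 0" and "z \<notin> \<real>"
    then have im: "Im z \<noteq> 0" by (simp add: complex_is_Real_iff)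
    then have z0: "z \<noteq> 0" "z \<noteq> of_real r" by auto
    have nz: "1 + z * of_real b \<noteq> 0" if "b \<in># B" for b
      using B[OF that] im by (auto simp: complex_eq_iff)
    have nr: "1 + complex_of_real r * of_real b \<noteq> 0" if "b \<in># B" for b
      using pos[OF that, of r] r by (metis less_irrefl less_le of_real_1 of_real_add of_real_eq_0_iff of_real_mult)
    define P where "P = map_poly complex_of_real p"
    have P: "P = (\<Prod>b\<in>#B. [:1, of_real b:])"
      by (simp add: P_def p_def map_poly_of_real_prod_linear)
    have "poly P z \<noteq> 0" unfolding P using nz by (intro poly_prod_mset_nonzero) auto
    moreover have "poly (pderiv P) z = poly P z * S z"
      unfolding P S_def using nz by (subst poly_pderiv_prod_mset) (auto simp: pderiv_pCons)
    moreover have "cpoly (bessel_comb p) z = (6 - z) * poly P z + z * (z + 18) * poly (pderiv P) z"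
      by (simp add: bessel_comb_def map_poly_of_real_add map_poly_of_real_mult map_poly_of_real_pderiv
          P_def[symmetric] map_poly_pCons algebra_simps del: mult_pCons_left mult_pCons_right)
    ultimately have "poly P z * ((6 - z) + z * ((z + 18) * S z)) = 0" "poly P z \<noteq> 0"
      using z by (simp_all add: algebra_simps)
    then have "(6 - z) + z * ((z + 18) * S z) = 0" by (metis mult_eq_0_iff)
    then have Sz: "(z + 18) * S z = 1 - 6 / z"
      using z0 by (simp add: field_simps)
    define k where "k = (\<lambda>b. b * (1 - 18 * b) / (1 + r * b))"
    define K where "K = (\<Sum>b\<in>#B. of_real (k b) / (1 + z * of_real b))"
    \<comment> \<open>The numerator of each term is \<open>(z + 18) (1 + r b) - (r + 18) (1 + z b) = (z - r) (1 - 18 b)\<close>.\<close>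
    have "(z + 18) * S z - (of_real r + 18) * S (of_real r) = (z - of_real r) * K"
      unfolding S_def K_def sum_mset_distrib_left using nz nr
    proof (induction B)
      case (add b B)
      have "(z + 18) * (of_real b / (1 + z * of_real b))
            - (of_real r + 18) * (of_real b / (1 + of_real r * of_real b))
          = (z - of_real r) * (of_real (k b) / (1 + z * of_real b))"
        using add.prems(1,2)[of b] by (simp add: k_def divide_simps) (simp add: algebra_simps)
      with add show ?case by (simp add: algebra_simps)
    qed simp
    also have "(z + 18) * S z - (of_real r + 18) * S (of_real r) = (z - of_real r) * (6 / (z * of_real r))"
      unfolding Sz Sr using z0 r by (simp add: field_simps)
    finally have "K = 6 / (z * of_real r)" using z0 by (metis eq_iff_diff_eq_0 mult_left_cancel)
    then have "K = of_real (6 / r) / z" by (simp add: mult.commute)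
    then have "Im z * Im K = (6 / r) * (- (Im z)\<^sup>2 / (cmod z)\<^sup>2)"
      by (simp only: Im_of_real_divide) (simp add: power2_eq_square)
    moreover have "\<dots> > 0"
      using r im z0 by (intro mult_neg_neg) (auto simp: divide_less_0_iff)
    moreover have "- (Im z * Im K) > 0"
    proof -
      have "- (Im z * Im K) = (\<Sum>b\<in>#B. - (Im z * Im (of_real (k b) / (1 + z * of_real b))))"
        unfolding K_def by (induction B) (auto simp: algebra_simps)
      also have "\<dots> > 0"
      proof (rule sum_mset_pos[OF _ ne])
        fix b assume b: "b \<in># B"
        have "k b > 0" unfolding k_def using B[OF b] pos[OF b, of r] r by simp
        moreover have "- (Im z * Im (of_real (k b) / (1 + z * of_real b)))
            = k b * (b * (Im z)\<^sup>2 / (cmod (1 + z * of_real b))\<^sup>2)"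
          by (simp only: Im_of_real_divide) (simp add: power2_eq_square)
        ultimately show "- (Im z * Im (of_real (k b) / (1 + z * of_real b))) > 0"
          using B[OF b] nz[OF b] im by simp
      qed
      finally show ?thesis .
    qed
    ultimately show False by simp
  qed
qed

lemma bessel_comb_laguerre_factorization:
  assumes "M \<ge> 1000"
  obtains B where "bessel_comb (laguerre M) = smult 6 (\<Prod>b\<in>#B. [:1, b:])" "\<And>b. b \<in># B \<Longrightarrow> b > 0"
proof -
  have c0: "coeff (laguerre M) 0 = 1" by (simp add: coeff_laguerre)
  have "real_rooted (bessel_comb (laguerre M))"
  proof (rule laguerre_factorization[OF assms])
    fix B assume "laguerre M = (\<Prod>b\<in>#B. [:1, b:])" "\<And>b. b \<in># B \<Longrightarrow> 0 < b \<and> b < 1 / 18"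
      "(\<Sum>b\<in>#B. b) = 1 / 6"
    then show ?thesis using real_rooted_bessel_comb[of B] by simp
  qed
  moreover have "coeff (bessel_comb (laguerre M)) j \<ge> 0" for j
  proof -
    consider "j = 0" | "j = Suc 0" | i where "j = Suc (Suc i)" by (metis not0_implies_Suc)
    then show ?thesis
    proof cases
      case 2
      \<comment> \<open>The only index at which the second term is negative.\<close>
      have "coeff (laguerre M) (Suc 0) = 1 / 6" using assms by (simp add: coeff_laguerre fact_numeral)
      then show ?thesis unfolding 2 coeff_bessel_comb c0 by simp
    next
      case 3
      show ?thesis unfolding 3 coeff_bessel_comb by (intro add_nonneg_nonneg mult_nonneg_nonneg) (auto simp: coeff_laguerre)
    qed (simp add: coeff_bessel_comb c0)
  qed
  moreover have b0: "coeff (bessel_comb (laguerre M)) 0 = 6" by (simp add: coeff_bessel_comb c0)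
  ultimately obtain B where "bessel_comb (laguerre M) = smult (coeff (bessel_comb (laguerre M)) 0) (\<Prod>b\<in>#B. [:1, b:])"
    "\<And>b. b \<in># B \<Longrightarrow> b > 0"
    by (metis real_rooted_pos_coeff_0_factorization zero_less_numeral)
  then show thesis unfolding b0 by (rule that)
qed

text \<open>The coefficients of \<open>6 (\<Sum>m. (1 / (m! (m + 1)!) - 1 / ((m - 4)! (m + 5)!)) x ^ m)\<close>, which at
  \<open>x = - t\<^sup>2 / 4\<close> is \<open>12 / t\<close> times \<open>J\<^sub>1 t - J\<^sub>9 t\<close>; here \<open>1 / (m - 4)!\<close> is \<open>0\<close> for \<open>m < 4\<close>.\<close>
definition weight :: "nat \<Rightarrow> real" where
  "weight j = 120 * (real j + 1) * ((real j)\<^sup>2 + 2 * real j + 6) / (fact j * fact (j + 5))"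

lemma weight_Suc: "weight (Suc j) = (18 * real j + 24) * (120 / (fact (Suc j) * fact (Suc j + 5)))
   + (real j - 1) * (120 / (fact j * fact (j + 5)))"
proof -
  have f: "fact (Suc j) = (real j + 1) * fact j" "fact (Suc j + 5) = (real j + 6) * fact (j + 5)"
    by (simp_all add: numeral_eq_Suc algebra_simps)
  define x u v where "x = real j" and "u = (fact j :: real)" and "v = (fact (j + 5) :: real)"
  have nz: "u \<noteq> 0" "v \<noteq> 0" "x + 1 \<noteq> 0" "x + 6 \<noteq> 0" by (auto simp: x_def u_def v_def simp del: fact_Suc)
  show ?thesis
    unfolding weight_def f using nz unfolding x_def[symmetric] u_def[symmetric] v_def[symmetric] of_nat_Suc
    by (simp add: divide_simps) algebra
qed

lemma coeff_bessel_comb_laguerre_tendsto: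
  "(\<lambda>M. coeff (bessel_comb (laguerre M)) j) \<longlonglongrightarrow> weight j"
proof (cases j)
  case 0
  have "(\<lambda>M. 6 * coeff (laguerre M) 0) \<longlonglongrightarrow> 6 * (fact 5 / (fact 0 * fact (0 + 5)))"
    by (intro tendsto_intros coeff_laguerre_tendsto)
  then show ?thesis by (simp add: 0 coeff_bessel_comb weight_def fact_numeral)
next
  case (Suc i)
  have "(\<lambda>M. (18 * real i + 24) * coeff (laguerre M) (Suc i) + (real i - 1) * coeff (laguerre M) i)
    \<longlonglongrightarrow> (18 * real i + 24) * (fact 5 / (fact (Suc i) * fact (Suc i + 5))) + (real i - 1) * (fact 5 / (fact i * fact (i + 5)))"
    by (intro tendsto_intros coeff_laguerre_tendsto)
  also have "fact 5 = (120 :: real)" by (simp add: fact_numeral)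
  finally show ?thesis unfolding Suc coeff_bessel_comb weight_Suc .
qed

section \<open>Umbral evaluation\<close>

text \<open>The linear functional on polynomials that sends \<open>x ^ m\<close> to \<open>w m\<close>.\<close>
definition umbral_eval :: "(nat \<Rightarrow> 'a) \<Rightarrow> 'a::comm_ring_1 poly \<Rightarrow> 'a" where
  "umbral_eval w q = (\<Sum>m\<le>degree q. coeff q m * w m)"

lemma umbral_eval_altdef:
  assumes "degree q \<le> N"
  shows "umbral_eval w q = (\<Sum>m\<le>N. coeff q m * w m)"
  unfolding umbral_eval_def using assms
  by (intro sum.mono_neutral_left) (auto simp: coeff_eq_0)

lemma umbral_eval_bounded_support:
  assumes "\<And>m. m > n \<Longrightarrow> w m = 0"
  shows "umbral_eval w q = (\<Sum>m\<le>n. coeff q m * w m)"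
proof -
  have "umbral_eval w q = (\<Sum>m\<le>max n (degree q). coeff q m * w m)"
    by (rule umbral_eval_altdef) simp
  also have "\<dots> = (\<Sum>m\<le>n. coeff q m * w m)"
    using assms by (intro sum.mono_neutral_right) auto
  finally show ?thesis .
qed

lemma umbral_eval_1: "umbral_eval w 1 = w 0"
  by (simp add: umbral_eval_def)

text \<open>Multiplication by a linear factor turns into a shift of the weights, which is why all evaluations
  at products of linear factors are computed by induction on the factors, with arbitrary weights.\<close>
lemma umbral_eval_linear_mult:
  "umbral_eval w ([:a, b:] * q) = a * umbral_eval w q + b * umbral_eval (\<lambda>m. w (Suc m)) q"
proof -
  define N where "N = degree q"
  have "degree ([:a, b:] * q) \<le> degree [:a, b:] + degree q" by (rule degree_mult_le)
  also have "degree [:a, b:] \<le> 1" by simp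
  finally have deg: "degree ([:a, b:] * q) \<le> Suc N" by (simp add: N_def)
  have "umbral_eval w ([:a, b:] * q) = (\<Sum>m\<le>Suc N. coeff ([:a, b:] * q) m * w m)"
    by (rule umbral_eval_altdef[OF deg])
  also have "\<dots> = (\<Sum>m\<le>Suc N. a * (coeff q m * w m)) + (\<Sum>m\<le>Suc N. coeff (pCons 0 (smult b q)) m * w m)"
    unfolding sum.distrib[symmetric] by (intro sum.cong refl) (simp add: algebra_simps)
  also have "(\<Sum>m\<le>Suc N. a * (coeff q m * w m)) = a * umbral_eval w q"
    unfolding sum_distrib_left[symmetric] by (subst umbral_eval_altdef[of q "Suc N"]) (auto simp: N_def)
  also have "(\<Sum>m\<le>Suc N. coeff (pCons 0 (smult b q)) m * w m) = b * umbral_eval (\<lambda>m. w (Suc m)) q"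
    unfolding sum.atMost_Suc_shift umbral_eval_def N_def
    by (simp add: sum_distrib_left mult.assoc)
  finally show ?thesis .
qed

lemma umbral_eval_add:
  "umbral_eval (\<lambda>m. v m + w m) q = umbral_eval v q + umbral_eval w q"
  by (simp add: umbral_eval_def algebra_simps sum.distrib)

lemma umbral_eval_smult_weight:
  "umbral_eval (\<lambda>m. c * w m) q = c * umbral_eval w q"
  by (simp add: umbral_eval_def sum_distrib_left mult_ac)

lemma higher_pderiv_pderiv: "(pderiv ^^ n) (pderiv h) = (pderiv ^^ Suc n) h"
  by (simp only: funpow_Suc_right o_apply)

text \<open>The evaluation is the value at \<open>t\<close> of the product of the differential operators \<open>1 + b D\<^sup>2\<close>
  applied to \<open>h\<close>. Each of them factors as \<open>(1 - \<mu> D) (1 + \<mu> D)\<close> with a purely imaginary \<open>\<mu>\<close>, and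
  each factor preserves the absence of zeros in the closed right half-plane.\<close>
lemma umbral_eval_half_plane:
  fixes h :: "complex poly" and B :: "real multiset"
  assumes "\<And>b. b \<in># B \<Longrightarrow> b > 0" "\<And>z. Re z \<ge> 0 \<Longrightarrow> poly h z \<noteq> 0" "Re t \<ge> 0"
  shows "umbral_eval (\<lambda>j. poly ((pderiv ^^ (2 * j)) h) t) (\<Prod>b\<in>#B. [:1, of_real b:]) \<noteq> 0"
  using assms
proof (induction B arbitrary: h)
  case empty
  then show ?case by (simp add: umbral_eval_1)
next
  case (add b B)
  define f where "f = (\<Prod>b\<in>#B. [:1, complex_of_real b:])"
  define \<mu> where "\<mu> = \<i> * of_real (sqrt b)"
  have \<mu>: "\<mu> * \<mu> = - of_real b"
    using add.prems(1)[of b] by (simp add: \<mu>_def algebra_simps flip: of_real_mult)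
  define g where "g = h + smult \<mu> (pderiv h)"
  define k where "k = g + smult (- \<mu>) (pderiv g)"
  have "poly g z \<noteq> 0" if "Re z \<ge> 0" for z
    unfolding g_def using add.prems(2) that
    by (intro half_plane_add_smult_pderiv[where u = 1 and c = 0]) (auto simp: \<mu>_def)
  then have k_nz: "poly k z \<noteq> 0" if "Re z \<ge> 0" for z
    unfolding k_def using that
    by (intro half_plane_add_smult_pderiv[where u = 1 and c = 0]) (auto simp: \<mu>_def)
  have k: "k = h + smult (of_real b) (pderiv (pderiv h))"
    by (simp add: k_def g_def pderiv_add pderiv_smult \<mu> smult_add_right)
  have hi: "(pderiv ^^ n) k = (pderiv ^^ n) h + smult (of_real b) ((pderiv ^^ n) (pderiv (pderiv h)))" for n
    unfolding k by (induction n) (simp_all add: pderiv_add pderiv_smult)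
  have "umbral_eval (\<lambda>j. poly ((pderiv ^^ (2 * j)) h) t) ([:1, of_real b:] * f) =
     umbral_eval (\<lambda>j. poly ((pderiv ^^ (2 * j)) k) t) f"
    unfolding umbral_eval_linear_mult umbral_eval_smult_weight[symmetric] mult_1 umbral_eval_add[symmetric]
    by (rule arg_cong[where f = "\<lambda>w. umbral_eval w f"]) (simp add: fun_eq_iff hi higher_pderiv_pderiv del: funpow.simps)
  also have "\<dots> \<noteq> 0" unfolding f_def by (rule add.IH[OF _ k_nz]) (use add.prems in auto)
  finally show ?case by (simp add: f_def del: mult_pCons_left mult_pCons_right)
qed

section \<open>Autocorrelation of the coefficients of a polynomial\<close>

text \<open>The coefficient of \<open>u ^ k\<close> in the Laurent polynomial \<open>(u + 1 / u) ^ m\<close>; the recursion makes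
  the evaluation of a polynomial at \<open>u + 1 / u\<close> compatible with multiplication by linear factors.\<close>
fun laurent_binom :: "nat \<Rightarrow> int \<Rightarrow> 'a::comm_ring_1" where
  "laurent_binom 0 k = (if k = 0 then 1 else 0)"
| "laurent_binom (Suc m) k = laurent_binom m (k - 1) + laurent_binom m (k + 1)"

lemma laurent_binom_eq_0: "k > int m \<or> k < - int m \<or> odd (int m + k) \<Longrightarrow> laurent_binom m k = 0"
proof (induction m arbitrary: k)
  case (Suc m)
  then have "laurent_binom m (k - 1) = (0::'a)" "laurent_binom m (k + 1) = (0::'a)"
    by (intro Suc.IH; auto)+
  then show ?case by simp
qed auto

lemma laurent_binom_eq: "i \<le> m \<Longrightarrow> laurent_binom m (int m - 2 * int i) = of_nat (m choose i)"
proof (induction m arbitrary: i)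
  case (Suc m)
  have 1: "laurent_binom m (int (Suc m) - 2 * int i - 1) = (of_nat (m choose i) :: 'a)"
  proof (cases "i \<le> m")
    case True
    then show ?thesis using Suc.IH[OF True] by simp
  next
    case False
    then have "i = Suc m" using Suc.prems by simp
    then show ?thesis by (simp add: laurent_binom_eq_0 binomial_eq_0)
  qed
  show ?case
  proof (cases i)
    case 0
    then show ?thesis using 1 by (simp add: laurent_binom_eq_0)
  next
    case (Suc l)
    then have "int (Suc m) - 2 * int i + 1 = int m - 2 * int l" by simp
    then have "laurent_binom m (int (Suc m) - 2 * int i + 1) = (of_nat (m choose l) :: 'a)"
      using Suc.IH[of l] Suc Suc.prems by simp
    then show ?thesis using 1 Suc by simp
  qed
qed simp

text \<open>For \<open>P = (\<Prod>s\<in>#S. [:s, 1:])\<close>, this is the polynomial whose value at \<open>u + 1 / u\<close> is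
  \<open>P (y u) * P (y / u)\<close>, since \<open>(s + y u) (s + y / u) = y\<^sup>2 + s\<^sup>2 + s y (u + 1 / u)\<close>.\<close>
definition autocorr :: "real multiset \<Rightarrow> complex \<Rightarrow> complex poly" where
  "autocorr S y = (\<Prod>s\<in>#S. [:y\<^sup>2 + of_real s ^ 2, of_real s * y:])"

lemma autocorr_add_mset:
  "autocorr (add_mset s S) y = [:y\<^sup>2 + of_real s ^ 2, of_real s * y:] * autocorr S y"
  by (simp add: autocorr_def)

text \<open>The left-hand side is the coefficient of \<open>u ^ k\<close> after substitution of \<open>u + 1 / u\<close>. Multiplying
  each of the \<open>size S\<close> factors by \<open>u\<close> yields a polynomial in \<open>u\<close>, which shifts the index by
  \<open>size S\<close>.\<close>
lemma umbral_eval_autocorr: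
  "umbral_eval (\<lambda>m. laurent_binom m k) (autocorr S y) =
   (if k < - int (size S) then 0 else
     coeff (\<Prod>s\<in>#S. [:of_real s * y, y\<^sup>2 + of_real s ^ 2, of_real s * y:]) (nat (int (size S) + k)))"
proof (induction S arbitrary: k)
  case empty
  show ?case by (auto simp: autocorr_def umbral_eval_1 nat_eq_iff)
next
  case (add s S)
  define q where "q = (\<Prod>s\<in>#S. [:of_real s * y, y\<^sup>2 + of_real s ^ 2, of_real s * y:])"
  define c where "c = (\<lambda>i. if i < 0 then 0 else coeff q (nat i))"
  have IH: "umbral_eval (\<lambda>m. laurent_binom m k) (autocorr S y) = c (int (size S) + k)" for k
    unfolding add.IH c_def q_def by auto
  have "umbral_eval (\<lambda>m. laurent_binom m k) (autocorr (add_mset s S) y) =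
      (y\<^sup>2 + of_real s ^ 2) * c (int (size S) + k) +
      of_real s * y * (c (int (size S) + k - 1) + c (int (size S) + k + 1))"
    unfolding autocorr_add_mset umbral_eval_linear_mult laurent_binom.simps umbral_eval_add IH
    by (simp add: algebra_simps)
  also have "\<dots> = (if int (size S) + k + 1 < 0 then 0 else
      coeff ([:of_real s * y, y\<^sup>2 + of_real s ^ 2, of_real s * y:] * q) (nat (int (size S) + k + 1)))"
  proof (cases "int (size S) + k + 1 < 0")
    case False
    then obtain n where n: "int (size S) + k + 1 = int n" by (metis int_nat_eq not_less)
    then have n': "int (size S) + k = int n - 1" by simp
    have "coeff ([:a, b, d:] * q) n = b * c (int n - 1) + a * (c (int n - 1 - 1) + c (int n - 1 + 1))"
      if "a = d" for a b d
    proof -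
      consider "n = 0" | "n = 1" | m where "n = Suc (Suc m)" by (metis One_nat_def not0_implies_Suc)
      then show ?thesis using that by cases (simp_all add: c_def nat_diff_distrib nat_add_distrib algebra_simps)
    qed
    then show ?thesis unfolding n n' by simp
  qed (simp add: c_def)
  moreover have "int (size (add_mset s S)) + k = int (size S) + k + 1"
    "k < - int (size (add_mset s S)) \<longleftrightarrow> int (size S) + k + 1 < 0" by auto
  ultimately show ?case by (simp only: q_def image_mset_add_mset prod_mset.add_mset)
qed

lemma coeff_prod_linear_scaled:
  "coeff (\<Prod>s\<in>#S. [:of_real s, y:]) i = complex_of_real (coeff (\<Prod>s\<in>#S. [:s, 1:]) i) * y ^ i"
proof (induction S arbitrary: i)
  case (add s S)
  then show ?case by (cases i) (simp_all add: algebra_simps)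
qed (auto simp: coeff_1)

lemma degree_prod_linear:
  fixes f :: "'b \<Rightarrow> 'a::idom"
  assumes "c \<noteq> 0"
  shows "degree (\<Prod>s\<in>#S. [:f s, c:]) = size S" "(\<Prod>s\<in>#S. [:f s, c:]) \<noteq> 0"
proof -
  have "degree (\<Prod>s\<in>#S. [:f s, c:]) = size S \<and> (\<Prod>s\<in>#S. [:f s, c:]) \<noteq> 0"
  proof (induction S)
    case (add s S)
    then show ?case using assms
      by (simp add: degree_mult_eq del: mult_pCons_left mult_pCons_right)
  qed simp
  then show "degree (\<Prod>s\<in>#S. [:f s, c:]) = size S" "(\<Prod>s\<in>#S. [:f s, c:]) \<noteq> 0" by auto
qed

lemma reflect_prod_linear:
  fixes y :: complex
  assumes "y \<noteq> 0"
  shows "reflect_poly (\<Prod>s\<in>#S. [:of_real s, y:]) = (\<Prod>s\<in>#S. [:y, of_real s:])"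
proof (induction S)
  case (add s S)
  have "reflect_poly [:complex_of_real s, y:] = [:y, of_real s:]"
    using assms by (intro poly_eqI) (auto simp: coeff_reflect_poly coeff_pCons split: nat.split)
  then show ?case using add
    by (simp only: image_mset_add_mset prod_mset.add_mset reflect_poly_mult)
qed simp

text \<open>The coefficient of \<open>u ^ k\<close> in \<open>P (y u) * P (y / u)\<close>, where \<open>P (y / u)\<close> is a reflected
  polynomial up to a power of \<open>u\<close>.\<close>
lemma umbral_eval_autocorr_shift:
  fixes S :: "real multiset"
  assumes "y \<noteq> 0"
  defines "P \<equiv> (\<Prod>s\<in>#S. [:s, 1:])"
  shows "umbral_eval (\<lambda>m. laurent_binom m (int k)) (autocorr S y) =
    (\<Sum>j\<le>size S. of_real (coeff P j * coeff P (j + k)) * y ^ (2 * j + k))"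
proof -
  define n where "n = size S"
  define p where "p = (\<Prod>s\<in>#S. [:complex_of_real s, y:])"
  have deg: "degree p = n" unfolding p_def n_def by (rule degree_prod_linear(1)[OF assms(1)])
  have "(\<Prod>s\<in>#S. [:of_real s * y, y\<^sup>2 + of_real s ^ 2, of_real s * y:]) = p * (\<Prod>s\<in>#S. [:y, of_real s:])"
    unfolding p_def prod_mset.distrib[symmetric]
    by (intro arg_cong[where f = prod_mset] image_mset_cong) (simp add: power2_eq_square algebra_simps)
  also have "\<dots> = p * reflect_poly p"
    by (simp only: p_def reflect_prod_linear[OF assms(1)])
  finally have "umbral_eval (\<lambda>m. laurent_binom m (int k)) (autocorr S y) = coeff (p * reflect_poly p) (n + k)"
    unfolding umbral_eval_autocorr n_def by (simp add: nat_add_distrib)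
  also have "\<dots> = (\<Sum>i\<le>n + k. coeff p i * coeff (reflect_poly p) (n + k - i))"
    by (rule coeff_mult)
  also have "\<dots> = (\<Sum>i\<in>{k..n + k}. coeff p i * coeff p (i - k))"
    by (intro sum.mono_neutral_cong_right) (auto simp: coeff_reflect_poly deg)
  also have "\<dots> = (\<Sum>j\<le>n. coeff p (j + k) * coeff p j)"
    by (rule sum.reindex_bij_witness[of _ "\<lambda>j. j + k" "\<lambda>i. i - k"]) auto
  also have "\<dots> = (\<Sum>j\<le>n. of_real (coeff P j * coeff P (j + k)) * y ^ (2 * j + k))"
    unfolding p_def P_def coeff_prod_linear_scaled
  proof (intro sum.cong refl)
    fix j
    have "y ^ (2 * j + k) = y ^ (j + k) * y ^ j" by (simp add: power_add[symmetric] mult_2 add_ac)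
    then show "of_real (coeff (\<Prod>s\<in>#S. [:s, 1:]) (j + k)) * y ^ (j + k) *
        (of_real (coeff (\<Prod>s\<in>#S. [:s, 1:]) j) * y ^ j) =
        complex_of_real (coeff (\<Prod>s\<in>#S. [:s, 1:]) j * coeff (\<Prod>s\<in>#S. [:s, 1:]) (j + k)) * y ^ (2 * j + k)"
      by simp
  qed
  finally show ?thesis by (simp add: n_def)
qed

text \<open>A zero of a factor with \<open>s > 0\<close> is \<open>- (y / s + s / y)\<close>, which has negative real part.\<close>
lemma autocorr_nonzero:
  assumes "Re y > 0" "Re t \<ge> 0" "\<And>s. s \<in># S \<Longrightarrow> s \<ge> 0"
  shows "poly (autocorr S y) t \<noteq> 0"
  unfolding autocorr_def
proof (rule poly_prod_mset_nonzero)
  fix s assume s: "s \<in># S"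
  have y0: "y \<noteq> 0" using assms(1) by auto
  show "poly [:y\<^sup>2 + of_real s ^ 2, of_real s * y:] t \<noteq> 0"
  proof (cases "s = 0")
    case False
    then have "s > 0" using assms(3)[OF s] by simp
    have "Re (y / of_real s) > 0" using assms(1) \<open>s > 0\<close> by simp
    moreover have "Re (of_real s / y) > 0"
      using assms(1) \<open>s > 0\<close> y0 by (simp add: Re_divide cmod_power2[symmetric])
    ultimately have "Re (y / of_real s + of_real s / y + t) > 0"
      using assms(2) by (simp only: plus_complex.sel)
    then have "y / of_real s + of_real s / y + t \<noteq> 0" by (metis less_irrefl zero_complex.sel(1))
    moreover have "poly [:y\<^sup>2 + of_real s ^ 2, of_real s * y:] t =
        of_real s * y * (y / of_real s + of_real s / y + t)"
      using y0 \<open>s > 0\<close> by (simp add: field_simps power2_eq_square)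
    ultimately show ?thesis using y0 \<open>s > 0\<close> by simp
  qed (use y0 in simp)
qed

lemma degree_autocorr_le: "degree (autocorr S y) \<le> size S"
proof (induction S)
  case (add s S)
  have "degree (autocorr (add_mset s S) y) \<le> degree [:y\<^sup>2 + of_real s ^ 2, of_real s * y:] + degree (autocorr S y)"
    unfolding autocorr_add_mset by (rule degree_mult_le)
  also have "degree [:y\<^sup>2 + of_real s ^ 2, of_real s * y:] \<le> 1" by simp
  finally show ?case using add by simp
qed (simp add: autocorr_def)

lemma degree_autocorr_pos:
  assumes "Re y > 0" "\<And>s. s \<in># S \<Longrightarrow> s \<ge> 0" "s \<in># S" "s \<noteq> 0"
  shows "degree (autocorr S y) > 0"
proof -
  obtain C where C: "S = add_mset s C" using multi_member_split[OF assms(3)] by blast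
  have "y \<noteq> 0" using assms(1) by auto
  have "poly (autocorr C y) 0 \<noteq> 0" using autocorr_nonzero[of y 0 C] assms(1,2) C by simp
  then have "autocorr C y \<noteq> 0" by auto
  then have "degree (autocorr S y) = degree [:y\<^sup>2 + of_real s ^ 2, of_real s * y:] + degree (autocorr C y)"
    unfolding C autocorr_add_mset using assms(4) \<open>y \<noteq> 0\<close> by (intro degree_mult_eq) auto
  then show ?thesis using assms(4) \<open>y \<noteq> 0\<close> by simp
qed

lemma coeff_autocorr_holomorphic: "(\<lambda>y. coeff (autocorr S y) m) holomorphic_on A"
proof (induction S arbitrary: m)
  case empty
  then show ?case by (simp add: autocorr_def)
next
  case (add s S)
  show ?case
    unfolding autocorr_add_mset by (cases m) (auto intro!: holomorphic_intros add)
qed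

section \<open>The operator as an umbral evaluation\<close>

text \<open>The left-hand side is the difference of the coefficients of \<open>u\<close> and \<open>u ^ 9\<close> in
  \<open>(u + 1 / u) ^ (2 j + 1)\<close>.\<close>
lemma binomial_difference:
  "real ((2 * j + 1) choose j) - (if 4 \<le> j then real ((2 * j + 1) choose (j - 4)) else 0) =
     fact (2 * j + 1) * weight j / 6"
proof (cases "4 \<le> j")
  case True
  then obtain i where j: "j = i + 4" by (metis add.commute le_Suc_ex)
  have a: "real ((2 * j + 1) choose j) = fact (2 * j + 1) / (fact (i + 4) * fact (i + 5))"
    by (simp add: binomial_fact j)
  have b: "real ((2 * j + 1) choose (j - 4)) = fact (2 * j + 1) / (fact i * fact (i + 9))"
    by (simp add: binomial_fact j)
  have f: "fact (i + 4) = (real i + 4) * (real i + 3) * (real i + 2) * (real i + 1) * fact i"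
    "fact (i + 9) = (real i + 9) * (real i + 8) * (real i + 7) * (real i + 6) * (fact (i + 5) :: real)"
    by (simp_all add: numeral_eq_Suc algebra_simps)
  have "1 / (fact (i + 4) * fact (i + 5)) - 1 / (fact i * fact (i + 9)) =
      20 * (real i + 5) * ((real i + 4)\<^sup>2 + 2 * (real i + 4) + 6) / (fact (i + 4) * fact (i + 9))"
  proof -
    have nz: "fact i \<noteq> (0::real)" "fact (i + 5) \<noteq> (0::real)" "real i + 9 \<noteq> 0" "real i + 8 \<noteq> 0"
      "real i + 7 \<noteq> 0" "real i + 6 \<noteq> 0" "real i + 4 \<noteq> 0" "real i + 3 \<noteq> 0" "real i + 2 \<noteq> 0" "real i + 1 \<noteq> 0"
      by (auto simp del: fact_Suc)
    define x u v where "x = real i" and "u = (fact i :: real)" and "v = (fact (i + 5) :: real)"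
    show ?thesis
      unfolding f using nz unfolding x_def[symmetric] u_def[symmetric] v_def[symmetric]
      by (simp add: divide_simps) algebra
  qed
  also have "\<dots> = weight j / 6"
  proof -
    have "weight j / 6 = 20 * (real j + 1) * ((real j)\<^sup>2 + 2 * real j + 6) / (fact j * fact (j + 5))"
    proof -
      have "120 * x * y / z / 6 = 20 * x * y / z" for x y z :: real by simp
      then show ?thesis unfolding weight_def .
    qed
    then show ?thesis by (simp add: j add_ac del: fact_Suc)
  qed
  finally have w: "weight j / 6 = 1 / (fact (i + 4) * fact (i + 5)) - 1 / (fact i * fact (i + 9))" ..
  have "real ((2 * j + 1) choose j) - real ((2 * j + 1) choose (j - 4)) = fact (2 * j + 1) * (weight j / 6)"
    unfolding a b w right_diff_distrib by simp
  then show ?thesis using True by simp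
next
  case False
  then have "j \<in> {0, 1, 2, 3}" by auto
  then show ?thesis by (auto simp: weight_def fact_numeral binomial_fact)
qed

lemma laurent_binom_difference_odd:
  "laurent_binom (2 * j + 1) 1 - laurent_binom (2 * j + 1) 9 = complex_of_real (fact (2 * j + 1) * weight j / 6)"
proof -
  have "laurent_binom (2 * j + 1) 1 = complex_of_real (real ((2 * j + 1) choose j))"
    using laurent_binom_eq[of j "2 * j + 1", where 'a = complex] by simp
  moreover have "laurent_binom (2 * j + 1) 9 =
      complex_of_real (if 4 \<le> j then real ((2 * j + 1) choose (j - 4)) else 0)"
  proof (cases "4 \<le> j")
    case True
    then have "int (2 * j + 1) - 2 * int (j - 4) = 9" by simp
    then show ?thesis using True laurent_binom_eq[of "j - 4" "2 * j + 1", where 'a = complex] by simp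
  qed (simp add: laurent_binom_eq_0)
  ultimately show ?thesis unfolding binomial_difference[symmetric] by (simp only: of_real_diff)
qed

text \<open>The derivative of order \<open>2 j + 1\<close> at \<open>0\<close> of the autocorrelation polynomial.\<close>
definition odd_coeff :: "real multiset \<Rightarrow> nat \<Rightarrow> complex \<Rightarrow> complex" where
  "odd_coeff S j y = fact (2 * j + 1) * coeff (autocorr S y) (2 * j + 1)"

text \<open>The derivative of the autocorrelation polynomial has no zero in the closed right half-plane, by
  the Gauss--Lucas theorem. The sum is the value at \<open>0\<close> of this derivative after the operator \<open>f (D\<^sup>2)\<close>, where \<open>f\<close>
  is \<open>6\<close> times a product of factors \<open>1 + b x\<close> with \<open>b > 0\<close>.\<close>
lemma approximant_nonzero:
  assumes "Re y > 0" "\<And>s. s \<in># S \<Longrightarrow> s \<ge> 0" "s \<in># S" "s \<noteq> 0" "M \<ge> 1000"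
  shows "(\<Sum>j\<le>size S. of_real (coeff (bessel_comb (laguerre M)) j) * odd_coeff S j y) \<noteq> 0"
proof (rule bessel_comb_laguerre_factorization[OF assms(5)])
  fix B assume B: "bessel_comb (laguerre M) = smult 6 (\<Prod>b\<in>#B. [:1, b:])" "\<And>b. b \<in># B \<Longrightarrow> b > 0"
  define h where "h = pderiv (autocorr S y)"
  have nz: "poly h z \<noteq> 0" if "Re z \<ge> 0" for z
    unfolding h_def
    by (rule half_plane_pderiv[where u = 1 and c = 0])
      (use that degree_autocorr_pos[OF assms(1-4)] autocorr_nonzero[OF assms(1) _ assms(2)] in auto)
  have w: "poly ((pderiv ^^ (2 * j)) h) 0 = odd_coeff S j y" for j
    unfolding h_def higher_pderiv_pderiv poly_0_coeff_0 coeff_higher_pderiv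
    by (simp add: odd_coeff_def pochhammer_fact[symmetric] del: fact_Suc)
  have "odd_coeff S j y = 0" if "j > size S" for j
    using degree_autocorr_le[of S y] that by (simp add: odd_coeff_def coeff_eq_0)
  then have "umbral_eval (\<lambda>j. odd_coeff S j y) (\<Prod>b\<in>#B. [:1, of_real b:]) =
      (\<Sum>j\<le>size S. coeff (\<Prod>b\<in>#B. [:1, of_real b:]) j * odd_coeff S j y)"
    by (rule umbral_eval_bounded_support)
  moreover have "umbral_eval (\<lambda>j. odd_coeff S j y) (\<Prod>b\<in>#B. [:1, of_real b:]) \<noteq> 0"
    using umbral_eval_half_plane[of B h 0] B(2) nz unfolding w by simp
  moreover have "complex_of_real (coeff (bessel_comb (laguerre M)) j) = 6 * coeff (\<Prod>b\<in>#B. [:1, of_real b:]) j" for j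
    unfolding B(1) using map_poly_of_real_prod_linear[of 1 B] 
    by (simp add: coeff_map_poly[of complex_of_real, symmetric])
  ultimately show ?thesis by (simp add: sum_distrib_left[symmetric] mult.assoc)
qed

lemma cpoly_altdef:
  assumes "degree p \<le> N"
  shows "cpoly p z = (\<Sum>k\<le>N. of_real (coeff p k) * z ^ k)"
proof -
  have "degree (map_poly complex_of_real p) \<le> N" using assms by (simp add: degree_map_poly)
  then have "cpoly p z = (\<Sum>k\<le>N. coeff (map_poly complex_of_real p) k * z ^ k)"
    unfolding poly_altdef by (intro sum.mono_neutral_left) (auto simp: coeff_eq_0)
  then show ?thesis by (simp add: coeff_map_poly)
qed

lemma degree_S_tilde_le: "r > 0 \<Longrightarrow> degree (S_tilde r p) \<le> degree p"
  by (intro degree_le) (auto simp: coeff_S_tilde coeff_eq_0)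

text \<open>The coefficients of \<open>u\<close> and \<open>u ^ 9\<close> in \<open>P (y u) * P (y / u)\<close> have the terms
  \<open>a k * a (k + 1) * y ^ (2 k + 1)\<close> and \<open>a j * a (j + 9) * y ^ (2 j + 9)\<close>; for \<open>k = j + 4\<close> these
  have the same power of \<open>y\<close>, and their difference is a coefficient of \<open>S_tilde 4 P\<close>. On the other
  side, the substitution of \<open>u + 1 / u\<close> gives binomial coefficients, and only odd powers
  contribute.\<close>
lemma S_tilde_autocorr:
  fixes S :: "real multiset"
  assumes "y \<noteq> 0"
  defines "P \<equiv> (\<Prod>s\<in>#S. [:s, 1:])"
  shows "6 * (y * cpoly (S_tilde 4 P) (y\<^sup>2)) = (\<Sum>j\<le>size S. of_real (weight j) * odd_coeff S j y)"
proof -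
  define n where "n = size S"
  define a where "a = (\<lambda>k. complex_of_real (coeff P k))"
  have deg: "degree P = n" unfolding P_def n_def by (rule degree_prod_linear(1)) simp
  have a0: "a k = 0" if "k > n" for k using that deg by (simp add: a_def coeff_eq_0)
  have S: "of_real (coeff (S_tilde 4 P) k) = a k * a (k + 1) - (if 4 \<le> k then a (k - 4) * a (k + 5) else 0)" for k
    by (simp add: coeff_S_tilde a_def add.commute)
  have "y * cpoly (S_tilde 4 P) (y\<^sup>2) = (\<Sum>k\<le>n + 4. of_real (coeff (S_tilde 4 P) k) * y ^ (2 * k + 1))"
    using degree_S_tilde_le[of 4 P] deg
    by (subst cpoly_altdef[of _ "n + 4"]) (auto simp: sum_distrib_left power_mult[symmetric] mult_ac)
  also have "\<dots> = (\<Sum>k\<le>n + 4. a k * a (k + 1) * y ^ (2 * k + 1))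
      - (\<Sum>k\<le>n + 4. (if 4 \<le> k then a (k - 4) * a (k + 5) else 0) * y ^ (2 * k + 1))"
    unfolding S by (simp add: sum_subtractf left_diff_distrib)
  also have "(\<Sum>k\<le>n + 4. a k * a (k + 1) * y ^ (2 * k + 1)) = (\<Sum>k\<le>n. a k * a (k + 1) * y ^ (2 * k + 1))"
    by (intro sum.mono_neutral_right) (auto simp: a0)
  also have "(\<Sum>k\<le>n + 4. (if 4 \<le> k then a (k - 4) * a (k + 5) else 0) * y ^ (2 * k + 1)) =
      (\<Sum>k\<in>{4..n + 4}. a (k - 4) * a (k + 5) * y ^ (2 * k + 1))"
    by (intro sum.mono_neutral_cong_right) auto
  also have "\<dots> = (\<Sum>j\<le>n. a j * a (j + 9) * y ^ (2 * j + 9))"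
    by (rule sum.reindex_bij_witness[of _ "\<lambda>j. j + 4" "\<lambda>k. k - 4"]) (auto simp: algebra_simps)
  also have "(\<Sum>k\<le>n. a k * a (k + 1) * y ^ (2 * k + 1)) = umbral_eval (\<lambda>m. laurent_binom m 1) (autocorr S y)"
    using umbral_eval_autocorr_shift[OF assms(1), of 1 S] by (simp add: a_def P_def n_def)
  also have "(\<Sum>j\<le>n. a j * a (j + 9) * y ^ (2 * j + 9)) = umbral_eval (\<lambda>m. laurent_binom m 9) (autocorr S y)"
    using umbral_eval_autocorr_shift[OF assms(1), of 9 S] by (simp add: a_def P_def n_def)
  also have "umbral_eval (\<lambda>m. laurent_binom m 1) (autocorr S y) - umbral_eval (\<lambda>m. laurent_binom m 9) (autocorr S y) =
      (\<Sum>m\<le>2 * n + 1. coeff (autocorr S y) m * (laurent_binom m 1 - laurent_binom m 9))"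
    using degree_autocorr_le[of S y]
    by (simp add: umbral_eval_altdef[of _ "2 * n + 1"] n_def right_diff_distrib sum_subtractf)
  also have "\<dots> = (\<Sum>m\<in>(\<lambda>j. 2 * j + 1) ` {..n}. coeff (autocorr S y) m * (laurent_binom m 1 - laurent_binom m 9))"
  proof (intro sum.mono_neutral_right ballI)
    fix m assume m: "m \<in> {..2 * n + 1} - (\<lambda>j. 2 * j + 1) ` {..n}"
    have "even m"
    proof (rule ccontr)
      assume "odd m"
      then obtain j where "m = 2 * j + 1" by (auto elim: oddE)
      then show False using m by auto
    qed
    then show "coeff (autocorr S y) m * (laurent_binom m 1 - laurent_binom m 9) = 0"
      by (simp add: laurent_binom_eq_0)
  qed auto
  also have "\<dots> = (\<Sum>j\<le>n. coeff (autocorr S y) (2 * j + 1) * (laurent_binom (2 * j + 1) 1 - laurent_binom (2 * j + 1) 9))"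
    by (subst sum.reindex) (auto simp: inj_on_def)
  also have "\<dots> = (\<Sum>j\<le>n. of_real (weight j) * odd_coeff S j y) / 6"
    unfolding laurent_binom_difference_odd sum_divide_distrib
    by (intro sum.cong refl) (simp add: odd_coeff_def mult_ac del: fact_Suc)
  finally show ?thesis by (simp add: n_def mult.commute)
qed

section \<open>Passage to the limit\<close>

lemma uniform_limit_scaled_sum:
  fixes g :: "nat \<Rightarrow> complex \<Rightarrow> complex"
  assumes a: "\<And>j. (\<lambda>M. a M j) \<longlonglongrightarrow> b j" and K: "compact K" "\<And>j. continuous_on K (g j)"
  shows "uniform_limit K (\<lambda>M y. \<Sum>j\<le>n. a M j * g j y) (\<lambda>y. \<Sum>j\<le>n. b j * g j y) sequentially"
proof -
  have 1: "uniform_limit K (\<lambda>M y. a M j * g j y) (\<lambda>y. b j * g j y) sequentially" for j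
  proof (rule uniform_lim_mult)
    show "uniform_limit K (\<lambda>M y. a M j) (\<lambda>y. b j) sequentially"
      using a[of j] by (auto simp: uniform_limit_iff tendsto_iff elim: eventually_mono)
    show "bounded (g j ` K)" using K by (simp add: compact_continuous_image compact_imp_bounded)
  qed (auto intro: uniform_limit_const bounded_subset[of "{b j}"])
  show ?thesis
    by (induction n) (auto intro!: uniform_limit_add 1)
qed

text \<open>Hurwitz's theorem on the open right half-plane, applied to the nonvanishing sums for the
  approximants of the weights. The limit is \<open>6 y Q (y\<^sup>2)\<close>; it vanishes at \<open>y = 0\<close>, so it could only be
  constant if \<open>Q = 0\<close>.\<close>
lemma S_tilde_nonzero_right_half_plane:
  fixes S :: "real multiset"
  defines "Q \<equiv> S_tilde 4 (\<Prod>s\<in>#S. [:s, 1:])"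
  assumes S: "\<And>s. s \<in># S \<Longrightarrow> s \<ge> 0" "s \<in># S" "s \<noteq> 0" and "Q \<noteq> 0" and y: "Re y > 0"
  shows "cpoly Q (y\<^sup>2) \<noteq> 0"
proof -
  define U where "U = {y. Re y > 0}"
  define G where "G = (\<lambda>y. 6 * (y * cpoly Q (y\<^sup>2)))"
  define W where "W = (\<lambda>M y. \<Sum>j\<le>size S. of_real (coeff (bessel_comb (laguerre (M + 1000))) j) * odd_coeff S j y)"
  have G: "G y = (\<Sum>j\<le>size S. of_real (weight j) * odd_coeff S j y)" if "y \<in> U" for y
  proof -
    have "y \<noteq> 0" using that by (auto simp: U_def)
    then show ?thesis unfolding G_def Q_def by (rule S_tilde_autocorr)
  qed
  have hol: "odd_coeff S j holomorphic_on A" for j A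
    unfolding odd_coeff_def by (intro holomorphic_intros coeff_autocorr_holomorphic)
  have "G y \<noteq> 0"
  proof (rule Hurwitz_no_zeros[of U W G])
    show "open U" "connected U"
      unfolding U_def by (auto simp: open_halfspace_Re_gt convex_halfspace_Re_gt intro: convex_connected)
    show "W M holomorphic_on U" for M
      unfolding W_def by (intro holomorphic_intros hol)
    show "G holomorphic_on U"
      unfolding G_def
      by (intro holomorphic_intros holomorphic_on_compose_gen[OF _ cpoly_holomorphic, unfolded o_def]) auto
    show "uniform_limit K W G sequentially" if K: "compact K" "K \<subseteq> U" for K
    proof -
      have "uniform_limit K W (\<lambda>y. \<Sum>j\<le>size S. of_real (weight j) * odd_coeff S j y) sequentially"
        unfolding W_def
        by (intro uniform_limit_scaled_sum tendsto_of_real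
            LIMSEQ_ignore_initial_segment[OF coeff_bessel_comb_laguerre_tendsto]
            K(1) holomorphic_on_imp_continuous_on hol)
      then show ?thesis
        using K(2) G by (subst uniform_limit_cong'[where g = W and i = "\<lambda>y. \<Sum>j\<le>size S. of_real (weight j) * odd_coeff S j y"]) auto
    qed
    show "W M z \<noteq> 0" if "z \<in> U" for M z
      using approximant_nonzero[of z S s "M + 1000"] S that by (simp add: W_def U_def)
    show "y \<in> U" using y by (simp add: U_def)
    show "\<not> G constant_on U"
    proof
      assume "G constant_on U"
      then obtain c where c: "\<And>z. z \<in> U \<Longrightarrow> G z = c" unfolding constant_on_def by blast
      define q where "q = [:0, 6:] * pcompose (map_poly complex_of_real Q) [:0, 0, 1:]"
      have q: "poly q z = G z" for z
        by (simp add: q_def G_def poly_pcompose power2_eq_square algebra_simps)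
      have inf: "infinite U"
        using y finite_imp_not_open[of U] by (auto simp: U_def open_halfspace_Re_gt)
      have "U \<subseteq> {z. poly (q - [:c:]) z = 0}" using c by (auto simp: q)
      then have "q - [:c:] = 0" using inf poly_roots_finite finite_subset by blast
      then have "q = [:c:]" by simp
      moreover have "poly q 0 = 0" by (simp add: q_def)
      ultimately have "q = 0" by simp
      then have "pcompose (map_poly complex_of_real Q) [:0, 0, 1:] = 0" by (simp add: q_def)
      then have "map_poly complex_of_real Q = 0"
        by (rule pcompose_eq_0) simp
      then show False using \<open>Q \<noteq> 0\<close> by (simp add: cpoly_eq_0_iff)
    qed
  qed
  then show ?thesis by (auto simp: G_def)
qed

lemma S_tilde_smult:
  assumes "r > 0" shows "S_tilde r (smult c p) = smult (c ^ 2) (S_tilde r p)"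
  using assms by (intro poly_eqI) (simp add: coeff_S_tilde power2_eq_square algebra_simps)

lemma S_tilde_monom:
  assumes "r > 0" shows "S_tilde r (monom 1 n) = 0"
  using assms by (intro poly_eqI) (auto simp: coeff_S_tilde)

lemma coeff_prod_linear_top:
  fixes S :: "'a::idom multiset"
  shows "coeff (\<Prod>s\<in>#S. [:s, 1:]) (size S) = 1"
    "S \<noteq> {#} \<Longrightarrow> coeff (\<Prod>s\<in>#S. [:s, 1:]) (size S - 1) = (\<Sum>s\<in>#S. s)"
proof -
  have deg: "degree (\<Prod>s\<in>#S. [:s, 1:]) = size S" for S :: "'a multiset"
    by (rule degree_prod_linear(1)) simp
  show top: "coeff (\<Prod>s\<in>#S. [:s, 1:]) (size S) = 1" for S :: "'a multiset"
    by (induction S) (simp_all add: deg coeff_eq_0)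
  show "S \<noteq> {#} \<Longrightarrow> coeff (\<Prod>s\<in>#S. [:s, 1:]) (size S - 1) = (\<Sum>s\<in>#S. s)"
  proof (induction S)
    case (add s S)
    then show ?case
    proof (cases "S = {#}")
      case False
      then obtain m where m: "size S = Suc m" by (metis not0_implies_Suc size_eq_0_iff_empty)
      then show ?thesis using add False top[of S] by simp
    qed simp
  qed simp
qed

lemma prod_linear_nonneg_coeffs:
  fixes S :: "real multiset"
  assumes "\<And>s. s \<in># S \<Longrightarrow> s \<ge> 0"
  shows "coeff (\<Prod>s\<in>#S. [:s, 1:]) k \<ge> 0"
  using assms
proof (induction S arbitrary: k)
  case (add s S)
  then show ?case by (cases k) auto
qed (simp add: coeff_1)

text \<open>Every zero of the image that is not a nonpositive real number has a square root with positive real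
  part, which is excluded. Hence all coefficients have the sign of the leading one. With the
  highest coefficients \<open>1\<close> and \<open>\<Sum>s\<in>#S. s\<close> of the product, this leading coefficient is their
  product, which is positive unless all \<open>s\<close> vanish; in the latter case the image is \<open>0\<close>.\<close>
lemma S_tilde_4_prod_linear:
  fixes S :: "real multiset"
  assumes S: "\<And>s. s \<in># S \<Longrightarrow> s \<ge> 0"
  shows "S_tilde 4 (\<Prod>s\<in>#S. [:s, 1:]) \<in> LP_plus_poly \<union> {0}"
proof (cases "\<exists>s. s \<in># S \<and> s \<noteq> 0")
  case False
  then have "(\<Prod>s\<in>#S. [:s, 1:]) = (\<Prod>s\<in>#S. [:0, 1:])"
    by (intro arg_cong[where f = prod_mset] image_mset_cong) auto
  also have "\<dots> = monom 1 (size S)" by (induction S) (simp_all add: monom_Suc)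
  finally show ?thesis by (simp add: S_tilde_monom)
next
  case True
  then obtain s where s: "s \<in># S" "s \<noteq> 0" by blast
  define P where "P = (\<Prod>s\<in>#S. [:s, 1:])"
  define Q where "Q = S_tilde 4 P"
  have ne: "S \<noteq> {#}" using s(1) by auto
  then obtain n where n: "size S = Suc n" by (metis not0_implies_Suc size_eq_0_iff_empty)
  have deg: "degree P = Suc n" unfolding P_def n[symmetric] by (rule degree_prod_linear(1)) simp
  have top: "coeff P (Suc n) = 1" "coeff P n = (\<Sum>s\<in>#S. s)"
    using coeff_prod_linear_top(1)[of S] coeff_prod_linear_top(2)[of S, OF ne] n by (simp_all add: P_def)
  obtain C where C: "S = add_mset s C" using multi_member_split[OF s(1)] by blast
  have "(\<Sum>s\<in>#C. s) \<ge> 0"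
  proof -
    have "\<And>s. s \<in># C \<Longrightarrow> s \<ge> 0" using S C by simp
    then show ?thesis by (induction C) auto
  qed
  moreover have "s > 0" using S[OF s(1)] s(2) by simp
  ultimately have "coeff P n > 0" unfolding top by (simp add: C)
  then have Qn: "coeff Q n > 0" using top(1) by (simp add: Q_def coeff_S_tilde coeff_eq_0 deg)
  have "coeff Q k = 0" if "k > n" for k
    using that by (simp add: Q_def coeff_S_tilde coeff_eq_0 deg)
  then have degQ: "degree Q = n" using Qn by (intro antisym degree_le le_degree) auto
  have "Q \<noteq> 0" using Qn by auto
  have roots: "z \<in> \<real> \<and> Re z \<le> 0" if "cpoly Q z = 0" for z
  proof (rule ccontr)
    assume "\<not> (z \<in> \<real> \<and> Re z \<le> 0)"
    moreover have "z \<in> \<real> \<and> Re z \<le> 0" if "Re (csqrt z) = 0"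
    proof -
      have "csqrt z = \<i> * of_real (Im (csqrt z))"
        using that by (simp add: complex_eq_iff del: csqrt.simps)
      then have "z = (\<i> * of_real (Im (csqrt z)))\<^sup>2" by (metis power2_csqrt)
      also have "\<dots> = of_real (- (Im (csqrt z))\<^sup>2)" by (simp add: power_mult_distrib del: csqrt.simps)
      finally obtain x where "z = of_real (- x\<^sup>2)" ..
      then show ?thesis by simp
    qed
    ultimately have "Re (csqrt z) > 0" using csqrt_principal[of z] by blast
    then have "cpoly Q ((csqrt z)\<^sup>2) \<noteq> 0"
      using S_tilde_nonzero_right_half_plane[OF S s(1,2)] \<open>Q \<noteq> 0\<close> unfolding Q_def P_def by blast
    then show False using that by simp
  qed
  then have rr: "real_rooted Q" by (auto simp: real_rooted_def)
  have "coeff Q k \<ge> 0" for k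
  proof (rule real_rooted_factorization[OF rr])
    fix A assume A: "Q = smult (lead_coeff Q) (\<Prod>x\<in>#A. [:-x, 1:])" "\<And>x. x \<in># A \<Longrightarrow> poly Q x = 0"
    have "x \<le> 0" if "x \<in># A" for x
      using roots[of "of_real x"] A(2)[OF that] by (simp add: cpoly_of_real)
    then have "coeff (\<Prod>s\<in>#image_mset uminus A. [:s, 1:]) k \<ge> 0"
      by (intro prod_linear_nonneg_coeffs) auto
    then have "coeff (\<Prod>x\<in>#A. [:-x, 1:]) k \<ge> 0" by (simp add: multiset.map_comp o_def)
    moreover have "lead_coeff Q > 0" using Qn degQ by simp
    ultimately have "coeff (smult (lead_coeff Q) (\<Prod>x\<in>#A. [:-x, 1:])) k \<ge> 0" by simp
    then show ?thesis using A(1) by metis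
  qed
  with rr have "Q \<in> LP_plus_poly" by (simp add: LP_plus_poly_iff)
  then show ?thesis by (simp add: Q_def P_def)
qed

theorem proposition12:
  shows "S_tilde 4 ` LP_plus_poly \<subseteq> LP_plus_poly \<union> {0}"
proof
  fix q assume "q \<in> S_tilde 4 ` LP_plus_poly"
  then obtain p where p: "p \<in> LP_plus_poly" "q = S_tilde 4 p" by blast
  then have rr: "real_rooted p" and nonneg: "\<And>k. coeff p k \<ge> 0"
    by (auto simp: LP_plus_poly_iff)
  show "q \<in> LP_plus_poly \<union> {0}"
  proof (rule real_rooted_nonneg_coeffs_factorization[OF rr nonneg])
    fix S assume S: "p = smult (lead_coeff p) (\<Prod>s\<in>#S. [:s, 1:])" "\<And>s. s \<in># S \<Longrightarrow> s \<ge> 0"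
    define c where "c = (lead_coeff p)\<^sup>2"
    define Q where "Q = S_tilde 4 (\<Prod>s\<in>#S. [:s, 1:])"
    have "c > 0" using real_rooted_nonzero[OF rr] by (simp add: c_def)
    have q: "q = smult c Q"
      unfolding p(2) c_def Q_def by (subst S(1)) (simp add: S_tilde_smult)
    have "Q \<in> LP_plus_poly \<union> {0}" unfolding Q_def by (rule S_tilde_4_prod_linear[OF S(2)])
    moreover have "smult c Q \<in> LP_plus_poly" if "Q \<in> LP_plus_poly"
    proof -
      have "map_poly complex_of_real (smult c Q) = smult (of_real c) (map_poly of_real Q)"
        by (intro poly_eqI) (simp add: coeff_map_poly)
      then show ?thesis using that \<open>c > 0\<close> by (auto simp: LP_plus_poly_iff real_rooted_def)
    qed
    ultimately show ?thesis by (auto simp: q)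
  qed
qed

end
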